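(* For every $L\in\mathbb N$ and $t\in\mathbb R$: (i) the projection $\mathbf\Pi_L:\mathfrak B\to\mathfrak B_L$ is completely positive; in particular it maps positive elements to positive elements, and so does $\pi_L=\mathbf\Pi_L\circ\pi:\mathfrak A\to\mathfrak B_L$; (ii) the projected Koopman operator $\mathcal U^{(t)}_L:\mathfrak B_L\to\mathfrak B_L$ is a quantum operation.
   Context: Let $\Phi^t:X\to X$, $t\in\mathbb R$, be a (measurable) dynamical flow on a completely metrizable, separable space $X$ with an ergodic, invariant, Borel probability measure $\mu$. Put $H=L^2(X,\mu)$, $\mathfrak A=L^\infty(X,\mu)$, $\mathfrak B=B(H)$. $U^tf=f\circ\Phi^t$ is the unitary Koopman operator on $H$. $\pi:\mathfrak A\to\mathfrak B$ maps $f$ to multiplication by $f$. Fix an orthonormal basis $\{\phi_0,\phi_1,\ldots\}$ of $H$ with $\phi_j\in\mathfrak A$. Let $H_L=\operatorname{span}\{\phi_0,\ldots,\phi_{L-1}\}$, let $\Pi_L:H\to H$ be the orthogonal projection onto $H_L$, and let $\mathfrak B_L=B(H_L)$, identified with the set of operators $A\in\mathfrak B$ with $\ker A\supseteq H_L^\perp$ and $\operatorname{ran}A\subseteq H_L$ (its unit is then $\Pi_L$). Define $\mathbf\Pi_LA=\Pi_LA\Pi_L$, $U_L^{(t)}=\Pi_LU^t\Pi_L$, and $\mathcal U_L^{(t)}A=U_L^{(t)}AU_L^{(t)*}$ for $A\in\mathfrak B_L$. A linear map $T:\mathfrak W_2\to\mathfrak W_1$ between von Neumann algebras is completely positive if for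 each $n\in\mathbb N$ the map $T\otimes\mathrm{Id}_n:M_n(\mathfrak W_2)\to M_n(\mathfrak W_1)$ is positive. It is a quantum operation if it is completely positive and is the adjoint of a map $T_*:\mathfrak W_{1*}\to\mathfrak W_{2*}$ of preduals such that $\omega_{T_*\rho}\mathbf 1\le 1$ for every normal state $\omega_\rho$ of $\mathfrak W_1$ (where $\mathbf 1$ is the unit of $\mathfrak W_2$, and $\omega_\sigma$ denotes the functional induced by $\sigma$ in the predual). For $\mathfrak B_L$ the functional induced by $\sigma$ is $\omega_\sigma A=\operatorname{tr}(\sigma A)$. *)

theory Defs
  imports "HOL-Probability.Probability" "HOL-Library.FuncSet" "HOL-Library.Complex_Order"
begin

text \<open>The order on \<^typ>\<open>complex\<close> is the one of \<^theory>\<open>HOL-Library.Complex_Order\<close>: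
  \<^term>\<open>0 \<le> (z::complex)\<close> says that \<open>z\<close> is real and nonnegative.\<close>


subsection \<open>Ergodic flows\<close>

definition measurable_flow :: "'x measure \<Rightarrow> (real \<Rightarrow> 'x \<Rightarrow> 'x) \<Rightarrow> bool" where
  "measurable_flow M \<Phi> \<longleftrightarrow>
     (\<lambda>(t, x). \<Phi> t x) \<in> measurable (borel \<Otimes>\<^sub>M M) M \<and>
     (\<forall>x\<in>space M. \<Phi> 0 x = x) \<and>
     (\<forall>s t. \<forall>x\<in>space M. \<Phi> (s + t) x = \<Phi> s (\<Phi> t x))"

definition flow_invariant :: "'x measure \<Rightarrow> (real \<Rightarrow> 'x \<Rightarrow> 'x) \<Rightarrow> bool" where
  "flow_invariant M \<Phi> \<longleftrightarrow> (\<forall>t. distr M M (\<Phi> t) = M)"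

definition flow_ergodic :: "'x measure \<Rightarrow> (real \<Rightarrow> 'x \<Rightarrow> 'x) \<Rightarrow> bool" where
  "flow_ergodic M \<Phi> \<longleftrightarrow>
     (\<forall>A\<in>sets M. (\<forall>t. \<Phi> t -` A \<inter> space M = A) \<longrightarrow> measure M A = 0 \<or> measure M A = 1)"


subsection \<open>The complex Hilbert space $L^2$ and the algebra $L^\infty$\<close>

text \<open>Elements of both spaces are classes of almost everywhere equal measurable functions.
  For a finite measure every class in \<open>Linf\<close> is thus literally a class in \<open>L2\<close>.\<close>

type_synonym 'x cls = "('x \<Rightarrow> complex) set"
type_synonym 'x oper = "'x cls \<Rightarrow> 'x cls"

definition ae_class :: "'x measure \<Rightarrow> ('x \<Rightarrow> complex) \<Rightarrow> 'x cls" where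
  "ae_class M f = {g \<in> borel_measurable M. AE x in M. g x = f x}"

definition rep :: "'x cls \<Rightarrow> 'x \<Rightarrow> complex" where
  "rep u = (SOME f. f \<in> u)"

definition L2 :: "'x measure \<Rightarrow> 'x cls set" where
  "L2 M = ae_class M ` {f \<in> borel_measurable M. integrable M (\<lambda>x. (cmod (f x))\<^sup>2)}"

definition Linf :: "'x measure \<Rightarrow> 'x cls set" where
  "Linf M = ae_class M ` {f \<in> borel_measurable M. \<exists>C. AE x in M. cmod (f x) \<le> C}"

definition Linf_positive :: "'x measure \<Rightarrow> 'x cls \<Rightarrow> bool" where
  "Linf_positive M a \<longleftrightarrow> a \<in> Linf M \<and> (AE x in M. 0 \<le> rep a x)"

definition l2_zero :: "'x measure \<Rightarrow> 'x cls" where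
  "l2_zero M = ae_class M (\<lambda>x. 0)"

definition l2_add :: "'x measure \<Rightarrow> 'x cls \<Rightarrow> 'x cls \<Rightarrow> 'x cls" where
  "l2_add M u v = ae_class M (\<lambda>x. rep u x + rep v x)"

definition l2_scale :: "'x measure \<Rightarrow> complex \<Rightarrow> 'x cls \<Rightarrow> 'x cls" where
  "l2_scale M c u = ae_class M (\<lambda>x. c * rep u x)"

definition l2_diff :: "'x measure \<Rightarrow> 'x cls \<Rightarrow> 'x cls \<Rightarrow> 'x cls" where
  "l2_diff M u v = ae_class M (\<lambda>x. rep u x - rep v x)"

definition l2_inner :: "'x measure \<Rightarrow> 'x cls \<Rightarrow> 'x cls \<Rightarrow> complex" where
  "l2_inner M u v = (\<integral>x. cnj (rep u x) * rep v x \<partial>M)"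

definition l2_norm :: "'x measure \<Rightarrow> 'x cls \<Rightarrow> real" where
  "l2_norm M u = sqrt (\<integral>x. (cmod (rep u x))\<^sup>2 \<partial>M)"

definition l2_subspace :: "'x measure \<Rightarrow> 'x cls set \<Rightarrow> bool" where
  "l2_subspace M V \<longleftrightarrow> V \<subseteq> L2 M \<and> l2_zero M \<in> V \<and>
     (\<forall>u\<in>V. \<forall>v\<in>V. l2_add M u v \<in> V) \<and> (\<forall>c. \<forall>u\<in>V. l2_scale M c u \<in> V)"

definition l2_span :: "'x measure \<Rightarrow> 'x cls set \<Rightarrow> 'x cls set" where
  "l2_span M S = l2_subspace M hull S"

definition l2_perp :: "'x measure \<Rightarrow> 'x cls set \<Rightarrow> 'x cls set" where
  "l2_perp M V = {u \<in> L2 M. \<forall>v\<in>V. l2_inner M v u = 0}"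

definition orthonormal_basis :: "'x measure \<Rightarrow> (nat \<Rightarrow> 'x cls) \<Rightarrow> bool" where
  "orthonormal_basis M \<phi> \<longleftrightarrow>
     (\<forall>j. \<phi> j \<in> L2 M) \<and>
     (\<forall>i j. l2_inner M (\<phi> i) (\<phi> j) = (if i = j then 1 else 0)) \<and>
     (\<forall>u\<in>L2 M. \<forall>e>0. \<exists>v\<in>l2_span M (range \<phi>). l2_norm M (l2_diff M u v) < e)"


subsection \<open>Bounded operators\<close>

text \<open>Operators are extensional functions on \<^term>\<open>L2 M\<close>, so that equality of operators is
  equality in HOL; composition is \<^const>\<open>compose\<close>.\<close>

definition bounded_ops :: "'x measure \<Rightarrow> 'x oper set" where
  "bounded_ops M = {A \<in> L2 M \<rightarrow>\<^sub>E L2 M.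
     (\<forall>u\<in>L2 M. \<forall>v\<in>L2 M. A (l2_add M u v) = l2_add M (A u) (A v)) \<and>
     (\<forall>c. \<forall>u\<in>L2 M. A (l2_scale M c u) = l2_scale M c (A u)) \<and>
     (\<exists>C. \<forall>u\<in>L2 M. l2_norm M (A u) \<le> C * l2_norm M u)}"

definition op_add :: "'x measure \<Rightarrow> 'x oper \<Rightarrow> 'x oper \<Rightarrow> 'x oper" where
  "op_add M A B = (\<lambda>u\<in>L2 M. l2_add M (A u) (B u))"

definition op_scale :: "'x measure \<Rightarrow> complex \<Rightarrow> 'x oper \<Rightarrow> 'x oper" where
  "op_scale M c A = (\<lambda>u\<in>L2 M. l2_scale M c (A u))"

definition op_comp :: "'x measure \<Rightarrow> 'x oper \<Rightarrow> 'x oper \<Rightarrow> 'x oper" where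
  "op_comp M A B = compose (L2 M) A B"

definition op_adjoint :: "'x measure \<Rightarrow> 'x oper \<Rightarrow> 'x oper" where
  "op_adjoint M A = (THE B. B \<in> bounded_ops M \<and>
     (\<forall>u\<in>L2 M. \<forall>v\<in>L2 M. l2_inner M (A u) v = l2_inner M u (B v)))"

definition op_positive :: "'x measure \<Rightarrow> 'x oper \<Rightarrow> bool" where
  "op_positive M A \<longleftrightarrow> A \<in> bounded_ops M \<and> (\<forall>u\<in>L2 M. 0 \<le> l2_inner M u (A u))"

definition orth_proj :: "'x measure \<Rightarrow> 'x cls set \<Rightarrow> 'x oper" where
  "orth_proj M V = (\<lambda>u\<in>L2 M. THE v. v \<in> V \<and> l2_diff M u v \<in> l2_perp M V)"

definition mult_op :: "'x measure \<Rightarrow> 'x cls \<Rightarrow> 'x oper" where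
  "mult_op M a = (\<lambda>u\<in>L2 M. ae_class M (\<lambda>x. rep a x * rep u x))"

definition koopman :: "'x measure \<Rightarrow> (real \<Rightarrow> 'x \<Rightarrow> 'x) \<Rightarrow> real \<Rightarrow> 'x oper" where
  "koopman M \<Phi> t = (\<lambda>u\<in>L2 M. ae_class M (\<lambda>x. rep u (\<Phi> t x)))"


subsection \<open>Complete positivity and quantum operations\<close>

definition op_linear :: "'x measure \<Rightarrow> 'x oper set \<Rightarrow> 'x oper set \<Rightarrow> ('x oper \<Rightarrow> 'x oper) \<Rightarrow> bool" where
  "op_linear M V W T \<longleftrightarrow> T \<in> V \<rightarrow> W \<and>
     (\<forall>A\<in>V. \<forall>B\<in>V. T (op_add M A B) = op_add M (T A) (T B)) \<and>
     (\<forall>c. \<forall>A\<in>V. T (op_scale M c A) = op_scale M c (T A))"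

definition op_matrices :: "nat \<Rightarrow> 'x oper set \<Rightarrow> (nat \<Rightarrow> nat \<Rightarrow> 'x oper) set" where
  "op_matrices n W = {A. \<forall>i<n. \<forall>j<n. A i j \<in> W}"

text \<open>An \<open>n \<times> n\<close> matrix of operators on \<open>L\<^sup>2\<close> acts on the direct sum of \<open>n\<close> copies of \<open>L\<^sup>2\<close>,
  and is positive if it is a positive operator there.\<close>

definition op_matrix_positive :: "'x measure \<Rightarrow> nat \<Rightarrow> (nat \<Rightarrow> nat \<Rightarrow> 'x oper) \<Rightarrow> bool" where
  "op_matrix_positive M n A \<longleftrightarrow> A \<in> op_matrices n (bounded_ops M) \<and>
     (\<forall>u. (\<forall>i<n. u i \<in> L2 M) \<longrightarrow> 0 \<le> (\<Sum>i<n. \<Sum>j<n. l2_inner M (u i) (A i j (u j))))"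

text \<open>\<open>T \<otimes> Id\<^sub>n\<close> is \<open>T\<close> applied to every entry.\<close>

definition completely_positive ::
  "'x measure \<Rightarrow> 'x oper set \<Rightarrow> 'x oper set \<Rightarrow> ('x oper \<Rightarrow> 'x oper) \<Rightarrow> bool" where
  "completely_positive M W2 W1 T \<longleftrightarrow> op_linear M W2 W1 T \<and>
     (\<forall>n. \<forall>A\<in>op_matrices n W2.
        op_matrix_positive M n A \<longrightarrow> op_matrix_positive M n (\<lambda>i j. T (A i j)))"

text \<open>A von Neumann algebra of operators on \<open>L\<^sup>2\<close>, with its unit (a projection, not
  necessarily the identity), a predual consisting of operators, and the functional
  \<open>functional \<sigma>\<close> on the algebra induced by an element \<open>\<sigma>\<close> of the predual.\<close>

record 'x vn_algebra =
  alg :: "'x oper set"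
  unit :: "'x oper"
  predual :: "'x oper set"
  functional :: "'x oper \<Rightarrow> 'x oper \<Rightarrow> complex"

definition normal_state :: "'x measure \<Rightarrow> 'x vn_algebra \<Rightarrow> 'x oper \<Rightarrow> bool" where
  "normal_state M W \<rho> \<longleftrightarrow> \<rho> \<in> predual W \<and>
     (\<forall>A\<in>alg W. op_positive M A \<longrightarrow> 0 \<le> functional W \<rho> A) \<and> functional W \<rho> (unit W) = 1"

text \<open>Boundedness of the predual map \<open>T\<^sub>*\<close> is not required separately: a linear map
  between Banach spaces that has an adjoint is bounded, by the closed graph theorem.\<close>

definition quantum_operation ::
  "'x measure \<Rightarrow> 'x vn_algebra \<Rightarrow> 'x vn_algebra \<Rightarrow> ('x oper \<Rightarrow> 'x oper) \<Rightarrow> bool" where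
  "quantum_operation M W2 W1 T \<longleftrightarrow> completely_positive M (alg W2) (alg W1) T \<and>
     (\<exists>Tp. op_linear M (predual W1) (predual W2) Tp \<and>
        (\<forall>\<rho>\<in>predual W1. \<forall>A\<in>alg W2. functional W1 \<rho> (T A) = functional W2 (Tp \<rho>) A) \<and>
        (\<forall>\<rho>. normal_state M W1 \<rho> \<longrightarrow> functional W2 (Tp \<rho>) (unit W2) \<le> 1))"


subsection \<open>Projection to finite dimension\<close>

definition HL :: "'x measure \<Rightarrow> (nat \<Rightarrow> 'x cls) \<Rightarrow> nat \<Rightarrow> 'x cls set" where
  "HL M \<phi> L = l2_span M (\<phi> ` {..<L})"

definition PiL :: "'x measure \<Rightarrow> (nat \<Rightarrow> 'x cls) \<Rightarrow> nat \<Rightarrow> 'x oper" where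
  "PiL M \<phi> L = orth_proj M (HL M \<phi> L)"

definition BL :: "'x measure \<Rightarrow> (nat \<Rightarrow> 'x cls) \<Rightarrow> nat \<Rightarrow> 'x oper set" where
  "BL M \<phi> L = {A \<in> bounded_ops M.
     (\<forall>u\<in>l2_perp M (HL M \<phi> L). A u = l2_zero M) \<and> (\<forall>u\<in>L2 M. A u \<in> HL M \<phi> L)}"

definition HL_trace :: "'x measure \<Rightarrow> (nat \<Rightarrow> 'x cls) \<Rightarrow> nat \<Rightarrow> 'x oper \<Rightarrow> complex" where
  "HL_trace M \<phi> L A = (\<Sum>j<L. l2_inner M (\<phi> j) (A (\<phi> j)))"

text \<open>\<open>H\<^sub>L\<close> has finite dimension, so all of its operators are trace class.\<close>

definition BL_algebra :: "'x measure \<Rightarrow> (nat \<Rightarrow> 'x cls) \<Rightarrow> nat \<Rightarrow> 'x vn_algebra" where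
  "BL_algebra M \<phi> L = \<lparr>alg = BL M \<phi> L, unit = PiL M \<phi> L, predual = BL M \<phi> L,
     functional = (\<lambda>\<sigma> A. HL_trace M \<phi> L (op_comp M \<sigma> A))\<rparr>"

definition op_PiL :: "'x measure \<Rightarrow> (nat \<Rightarrow> 'x cls) \<Rightarrow> nat \<Rightarrow> 'x oper \<Rightarrow> 'x oper" where
  "op_PiL M \<phi> L A = op_comp M (PiL M \<phi> L) (op_comp M A (PiL M \<phi> L))"

definition pi_L :: "'x measure \<Rightarrow> (nat \<Rightarrow> 'x cls) \<Rightarrow> nat \<Rightarrow> 'x cls \<Rightarrow> 'x oper" where
  "pi_L M \<phi> L a = op_PiL M \<phi> L (mult_op M a)"

definition koopman_L ::
  "'x measure \<Rightarrow> (real \<Rightarrow> 'x \<Rightarrow> 'x) \<Rightarrow> (nat \<Rightarrow> 'x cls) \<Rightarrow> nat \<Rightarrow> real \<Rightarrow> 'x oper" where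
  "koopman_L M \<Phi> \<phi> L t = op_PiL M \<phi> L (koopman M \<Phi> t)"

definition op_koopman_L ::
  "'x measure \<Rightarrow> (real \<Rightarrow> 'x \<Rightarrow> 'x) \<Rightarrow> (nat \<Rightarrow> 'x cls) \<Rightarrow> nat \<Rightarrow> real \<Rightarrow> 'x oper \<Rightarrow> 'x oper" where
  "op_koopman_L M \<Phi> \<phi> L t A =
     op_comp M (koopman_L M \<Phi> \<phi> L t) (op_comp M A (op_adjoint M (koopman_L M \<Phi> \<phi> L t)))"

end

theory Submission
  imports Defs
begin

text \<open>Both maps of the theorem are conjugations \<open>A \<mapsto> W A V\<close> with \<open>W\<close> the adjoint of \<open>V\<close>: the
  projection has \<open>V = W = \<Pi>\<^sub>L\<close>, and the projected Koopman operator has \<open>W = U\<close> and \<open>V = U\<^sup>*\<close>, where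
  \<open>U = \<Pi>\<^sub>L U\<^sup>t \<Pi>\<^sub>L\<close>. Such a map is completely positive because moving \<open>W\<close> to the other side of
  the inner product turns the quadratic form of the matrix \<open>(W A\<^sub>i\<^sub>j V)\<close> at \<open>(u\<^sub>i)\<close> into that of
  \<open>(A\<^sub>i\<^sub>j)\<close> at \<open>(V u\<^sub>i)\<close> (\<open>conjugation_completely_positive\<close>). Positivity of \<open>\<pi>\<^sub>L f\<close> follows, as
  multiplication by \<open>f \<ge> 0\<close> is a positive operator.

  For the second map to be a quantum operation it also needs a map of preduals. By cyclicity of
  the trace, \<open>tr (\<rho> U A U\<^sup>*) = tr ((U\<^sup>* \<rho> U) A)\<close>, so that map is \<open>\<rho> \<mapsto> U\<^sup>* \<rho> U\<close>. Its value
  at the unit is \<open>tr (\<rho> U U\<^sup>*)\<close>. The Koopman operator is an isometry since the flow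
  preserves the measure, so \<open>U\<close> and \<open>U\<^sup>*\<close> are contractions, \<open>\<Pi>\<^sub>L - U U\<^sup>*\<close> is a positive element
  of the algebra (\<open>projection_minus_conjugate_positive\<close>), and for a state \<open>\<rho>\<close> its nonnegative
  value \<open>1 - tr (\<rho> U U\<^sup>*)\<close> gives the bound.

  The projection onto \<open>H\<^sub>L\<close> and the adjoints of operators in \<open>B\<^sub>L\<close> are given by finite sums over
  \<open>\<phi>\<^sub>0, \<dots>, \<phi>\<^bsub>L-1\<^esub>\<close>. Nondegeneracy of the inner product (\<open>l2_eqI\<close>) reduces
  most identities between almost everywhere classes to identities between complex numbers.\<close>

section \<open>The calculus of classes in $L^2$\<close>

definition square_integrable :: "'x measure \<Rightarrow> ('x \<Rightarrow> complex) \<Rightarrow> bool" where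
  "square_integrable M f \<longleftrightarrow> f \<in> borel_measurable M \<and> integrable M (\<lambda>x. (cmod (f x))\<^sup>2)"

lemma ae_class_eq_iff:
  assumes [measurable]: "f \<in> borel_measurable M" "g \<in> borel_measurable M"
  shows "ae_class M f = ae_class M g \<longleftrightarrow> (AE x in M. f x = g x)"
proof
  assume "ae_class M f = ae_class M g"
  moreover have "f \<in> ae_class M f" by (simp add: ae_class_def)
  ultimately show "AE x in M. f x = g x" by (simp add: ae_class_def)
next
  assume *: "AE x in M. f x = g x"
  have "(AE x in M. h x = f x) \<longleftrightarrow> (AE x in M. h x = g x)" for h
    using * by auto
  then show "ae_class M f = ae_class M g" by (simp add: ae_class_def)
qed

lemma
  assumes "f \<in> borel_measurable M"
  shows rep_ae_class_measurable: "rep (ae_class M f) \<in> borel_measurable M"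
    and rep_ae_class_AE: "AE x in M. rep (ae_class M f) x = f x"
proof -
  have "f \<in> ae_class M f" using assms by (simp add: ae_class_def)
  then have "rep (ae_class M f) \<in> ae_class M f" unfolding rep_def by (rule someI[where P = "\<lambda>h. h \<in> ae_class M f"])
  then show "rep (ae_class M f) \<in> borel_measurable M" "AE x in M. rep (ae_class M f) x = f x"
    by (simp_all add: ae_class_def)
qed

lemma square_integrable_cong_AE:
  assumes "square_integrable M f" "g \<in> borel_measurable M" "AE x in M. g x = f x"
  shows "square_integrable M g"
proof -
  have [measurable]: "f \<in> borel_measurable M" "g \<in> borel_measurable M"
    using assms by (auto simp: square_integrable_def)
  have "integrable M (\<lambda>x. (cmod (g x))\<^sup>2) \<longleftrightarrow> integrable M (\<lambda>x. (cmod (f x))\<^sup>2)"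
    using assms(3) by (intro integrable_cong_AE) auto
  then show ?thesis using assms by (simp add: square_integrable_def)
qed

lemma ae_class_in_L2: "square_integrable M f \<Longrightarrow> ae_class M f \<in> L2 M"
  by (auto simp: L2_def square_integrable_def)

lemma rep_L2:
  assumes "u \<in> L2 M" shows "square_integrable M (rep u)"
proof -
  obtain f where f: "u = ae_class M f" "square_integrable M f"
    using assms by (auto simp: L2_def square_integrable_def)
  then have [measurable]: "f \<in> borel_measurable M" by (simp add: square_integrable_def)
  show ?thesis unfolding f(1)
    by (rule square_integrable_cong_AE[OF f(2) rep_ae_class_measurable rep_ae_class_AE]) simp_all
qed

lemma rep_L2_measurable [measurable]: "u \<in> L2 M \<Longrightarrow> rep u \<in> borel_measurable M"
  using rep_L2 by (auto simp: square_integrable_def)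

lemma ae_class_rep:
  assumes "u \<in> L2 M" shows "ae_class M (rep u) = u"
proof -
  obtain f where f: "u = ae_class M f" "f \<in> borel_measurable M"
    using assms by (auto simp: L2_def)
  show ?thesis unfolding f(1)
    by (subst ae_class_eq_iff) (use f(2) rep_ae_class_measurable rep_ae_class_AE in auto)
qed

lemma L2_eqI_AE:
  assumes "u \<in> L2 M" "v \<in> L2 M" "AE x in M. rep u x = rep v x"
  shows "u = v"
  using assms by (metis ae_class_eq_iff ae_class_rep rep_L2_measurable)

lemma square_integrable_add:
  assumes "square_integrable M f" "square_integrable M g"
  shows "square_integrable M (\<lambda>x. f x + g x)"
proof -
  have [measurable]: "f \<in> borel_measurable M" "g \<in> borel_measurable M"
    using assms by (auto simp: square_integrable_def)
  have "integrable M (\<lambda>x. 2 * (cmod (f x))\<^sup>2 + 2 * (cmod (g x))\<^sup>2)"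
    using assms by (auto simp: square_integrable_def)
  then have "integrable M (\<lambda>x. (cmod (f x + g x))\<^sup>2)"
  proof (rule Bochner_Integration.integrable_bound)
    have "(cmod (a + b))\<^sup>2 \<le> 2 * (cmod a)\<^sup>2 + 2 * (cmod b)\<^sup>2" for a b
    proof -
      have "(cmod (a + b))\<^sup>2 \<le> (cmod a + cmod b)\<^sup>2"
        by (simp add: norm_triangle_ineq power_mono)
      moreover have "0 \<le> (cmod a - cmod b)\<^sup>2" by simp
      ultimately show ?thesis unfolding power2_sum power2_diff by linarith
    qed
    then show "AE x in M. norm ((cmod (f x + g x))\<^sup>2) \<le> norm (2 * (cmod (f x))\<^sup>2 + 2 * (cmod (g x))\<^sup>2)"
      by auto
  qed simp
  then show ?thesis by (simp add: square_integrable_def)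
qed

lemma square_integrable_scale:
  assumes "square_integrable M f" shows "square_integrable M (\<lambda>x. c * f x)"
  using assms by (auto simp: square_integrable_def norm_mult power_mult_distrib)

lemma square_integrable_zero: "square_integrable M (\<lambda>x. 0)"
  by (simp add: square_integrable_def)

lemma square_integrable_diff:
  assumes "square_integrable M f" "square_integrable M g"
  shows "square_integrable M (\<lambda>x. f x - g x)"
  using square_integrable_add[OF assms(1) square_integrable_scale[OF assms(2), of "-1"]] by simp

lemma borel_measurable_cnj [measurable]:
  "f \<in> borel_measurable M \<Longrightarrow> (\<lambda>x. cnj (f x)) \<in> borel_measurable M"
  by (rule borel_measurable_continuous_on[where f = cnj]) (auto intro: continuous_intros)

lemma integrable_cnj_mult:
  assumes "square_integrable M f" "square_integrable M g"
  shows "integrable M (\<lambda>x. cnj (f x) * g x)"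
proof -
  have [measurable]: "f \<in> borel_measurable M" "g \<in> borel_measurable M"
    using assms by (auto simp: square_integrable_def)
  have "integrable M (\<lambda>x. (cmod (f x))\<^sup>2 + (cmod (g x))\<^sup>2)"
    using assms by (auto simp: square_integrable_def)
  then show ?thesis
  proof (rule Bochner_Integration.integrable_bound)
    have "cmod a * cmod b \<le> (cmod a)\<^sup>2 + (cmod b)\<^sup>2" for a b
      using zero_le_power2[of "cmod a - cmod b"] zero_le_power2[of "cmod a"] zero_le_power2[of "cmod b"]
      unfolding power2_diff by linarith
    then show "AE x in M. norm (cnj (f x) * g x) \<le> norm ((cmod (f x))\<^sup>2 + (cmod (g x))\<^sup>2)"
      by (auto simp: norm_mult)
  qed simp
qed

lemma l2_closed [simp]:
  shows l2_zero_closed: "l2_zero M \<in> L2 M"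
    and l2_add_closed: "u \<in> L2 M \<Longrightarrow> v \<in> L2 M \<Longrightarrow> l2_add M u v \<in> L2 M"
    and l2_scale_closed: "u \<in> L2 M \<Longrightarrow> l2_scale M c u \<in> L2 M"
    and l2_diff_closed: "u \<in> L2 M \<Longrightarrow> v \<in> L2 M \<Longrightarrow> l2_diff M u v \<in> L2 M"
  unfolding l2_zero_def l2_add_def l2_scale_def l2_diff_def
  by (intro ae_class_in_L2 square_integrable_zero square_integrable_add square_integrable_scale
      square_integrable_diff rep_L2; assumption)+

lemma l2_inner_ae_class:
  assumes "u \<in> L2 M" "square_integrable M g"
  shows "l2_inner M u (ae_class M g) = (\<integral>x. cnj (rep u x) * g x \<partial>M)"
proof -
  have [measurable]: "g \<in> borel_measurable M" using assms by (auto simp: square_integrable_def)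
  note [measurable] = rep_L2_measurable[OF assms(1)] rep_ae_class_measurable[of g M]
  show ?thesis unfolding l2_inner_def
    using rep_ae_class_AE[of g M] by (intro integral_cong_AE) auto
qed

lemma l2_inner_commute: "l2_inner M u v = cnj (l2_inner M v u)"
proof -
  have "cnj (l2_inner M v u) = (\<integral>x. cnj (cnj (rep v x) * rep u x) \<partial>M)"
    unfolding l2_inner_def by (rule Bochner_Integration.integral_cnj[symmetric])
  also have "\<dots> = l2_inner M u v" by (simp add: l2_inner_def mult.commute)
  finally show ?thesis by simp
qed

lemma l2_inner_right:
  assumes "u \<in> L2 M"
  shows l2_inner_zero_right: "l2_inner M u (l2_zero M) = 0"
    and l2_inner_scale_right: "v \<in> L2 M \<Longrightarrow> l2_inner M u (l2_scale M c v) = c * l2_inner M u v"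
    and l2_inner_add_right: "v \<in> L2 M \<Longrightarrow> w \<in> L2 M \<Longrightarrow>
      l2_inner M u (l2_add M v w) = l2_inner M u v + l2_inner M u w"
    and l2_inner_diff_right: "v \<in> L2 M \<Longrightarrow> w \<in> L2 M \<Longrightarrow>
      l2_inner M u (l2_diff M v w) = l2_inner M u v - l2_inner M u w"
proof -
  note u = assms and [simp] = rep_L2 integrable_cnj_mult square_integrable_zero
    square_integrable_add square_integrable_scale square_integrable_diff
  show "l2_inner M u (l2_zero M) = 0"
    using u by (simp add: l2_zero_def l2_inner_ae_class)
  show "l2_inner M u (l2_scale M c v) = c * l2_inner M u v" if "v \<in> L2 M"
    using u that by (simp add: l2_scale_def l2_inner_ae_class mult.left_commute) (simp add: l2_inner_def)
  show "l2_inner M u (l2_add M v w) = l2_inner M u v + l2_inner M u w" if "v \<in> L2 M" "w \<in> L2 M"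
    using u that by (simp add: l2_add_def l2_inner_ae_class distrib_left) (simp add: l2_inner_def)
  show "l2_inner M u (l2_diff M v w) = l2_inner M u v - l2_inner M u w" if "v \<in> L2 M" "w \<in> L2 M"
    using u that by (simp add: l2_diff_def l2_inner_ae_class right_diff_distrib) (simp add: l2_inner_def)
qed

lemma l2_inner_left:
  assumes "u \<in> L2 M"
  shows l2_inner_zero_left: "l2_inner M (l2_zero M) u = 0"
    and l2_inner_scale_left: "v \<in> L2 M \<Longrightarrow> l2_inner M (l2_scale M c v) u = cnj c * l2_inner M v u"
    and l2_inner_add_left: "v \<in> L2 M \<Longrightarrow> w \<in> L2 M \<Longrightarrow>
      l2_inner M (l2_add M v w) u = l2_inner M v u + l2_inner M w u"
    and l2_inner_diff_left: "v \<in> L2 M \<Longrightarrow> w \<in> L2 M \<Longrightarrow>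
      l2_inner M (l2_diff M v w) u = l2_inner M v u - l2_inner M w u"
  using l2_inner_right[OF assms] l2_inner_commute[of M _ u] by (simp_all)

lemma l2_norm_nonneg [simp]: "0 \<le> l2_norm M u"
  by (simp add: l2_norm_def)

lemma l2_inner_self: "l2_inner M u u = of_real ((l2_norm M u)\<^sup>2)"
proof -
  have "cnj z * z = of_real ((cmod z)\<^sup>2)" for z
    by (simp add: complex_norm_square mult.commute del: of_real_power)
  then have "l2_inner M u u = (\<integral>x. complex_of_real ((cmod (rep u x))\<^sup>2) \<partial>M)"
    by (simp add: l2_inner_def)
  then show ?thesis by (simp add: l2_norm_def del: of_real_power)
qed

lemma l2_inner_self_nonneg: "0 \<le> l2_inner M u u"
  by (simp add: l2_inner_self less_eq_complex_def del: of_real_power)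

lemma l2_inner_self_eq_0:
  assumes "u \<in> L2 M" "l2_inner M u u = 0" shows "u = l2_zero M"
proof -
  have "(\<integral>x. (cmod (rep u x))\<^sup>2 \<partial>M) = 0"
    using assms(2) unfolding l2_inner_self by (simp add: l2_norm_def)
  then have *: "AE x in M. (cmod (rep u x))\<^sup>2 = 0"
    using rep_L2[OF assms(1)]
    by (subst (asm) integral_nonneg_eq_0_iff_AE) (auto simp: square_integrable_def)
  have "AE x in M. rep u x = rep (l2_zero M) x"
    using * rep_ae_class_AE[of "\<lambda>x. 0" M] unfolding l2_zero_def by auto
  then show ?thesis using assms by (intro L2_eqI_AE) auto
qed

text \<open>Testing against all vectors replaces any further handling of representatives: the
  rules above then compute both sides.\<close>

lemma l2_eqI:
  assumes "u \<in> L2 M" "v \<in> L2 M" "\<And>w. w \<in> L2 M \<Longrightarrow> l2_inner M w u = l2_inner M w v"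
  shows "u = v"
proof -
  let ?d = "l2_diff M u v"
  have "l2_inner M ?d ?d = 0" using assms by (simp add: l2_inner_right)
  then have "?d = l2_zero M" using assms by (intro l2_inner_self_eq_0) auto
  then have "AE x in M. rep u x - rep v x = 0" using assms
    by (simp add: l2_diff_def l2_zero_def ae_class_eq_iff)
  then show ?thesis using assms by (intro L2_eqI_AE) auto
qed

text \<open>The vector \<open>w = v - (\<langle>u, v\<rangle> / \<parallel>u\<parallel>\<^sup>2) u\<close> is what remains of \<open>v\<close> after projection along \<open>u\<close>;
  the inequality is \<open>0 \<le> \<parallel>w\<parallel>\<^sup>2\<close> written out.\<close>

lemma l2_cauchy_schwarz:
  assumes "u \<in> L2 M" "v \<in> L2 M"
  shows "cmod (l2_inner M u v) \<le> l2_norm M u * l2_norm M v"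
proof (cases "l2_norm M u = 0")
  case True
  then have "u = l2_zero M" using assms by (intro l2_inner_self_eq_0) (auto simp: l2_inner_self)
  then show ?thesis using assms by (simp add: l2_inner_left)
next
  case False
  define n z where "n = (l2_norm M u)\<^sup>2" and "z = l2_inner M u v"
  have n: "n > 0" using False by (simp add: n_def)
  let ?w = "l2_diff M v (l2_scale M (z / of_real n) u)"
  have "l2_inner M ?w ?w = of_real ((l2_norm M v)\<^sup>2 - (cmod z)\<^sup>2 / n)"
  proof -
    have uu: "l2_inner M u u = of_real n" and vu: "l2_inner M v u = cnj z" and uv: "l2_inner M u v = z"
      using l2_inner_commute[of M v u] by (simp_all only: l2_inner_self n_def z_def)
    have "l2_inner M ?w ?w = l2_inner M v v - z * cnj z / of_real n"
      using assms n by (simp add: l2_inner_right l2_inner_left uu uv vu field_simps)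
    then show ?thesis
      unfolding complex_norm_square[symmetric] by (simp add: l2_inner_self)
  qed
  then have "0 \<le> (l2_norm M v)\<^sup>2 - (cmod z)\<^sup>2 / n"
    using l2_inner_self_nonneg[of M ?w] by (simp add: less_eq_complex_def)
  then have "(cmod z)\<^sup>2 \<le> (l2_norm M u * l2_norm M v)\<^sup>2"
    using n by (simp add: field_simps power_mult_distrib n_def)
  then show ?thesis unfolding z_def by (rule power2_le_imp_le) simp
qed


text \<open>Duality turns bounds on inner products, which pass through adjoints, into bounds on norms.
  The test vector is \<open>u\<close> itself.\<close>

lemma l2_norm_leI:
  assumes "u \<in> L2 M" "0 \<le> C" "\<And>w. w \<in> L2 M \<Longrightarrow> cmod (l2_inner M w u) \<le> C * l2_norm M w"
  shows "l2_norm M u \<le> C"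
proof (cases "l2_norm M u = 0")
  case False
  have "l2_norm M u * l2_norm M u \<le> C * l2_norm M u"
    using assms(3)[OF assms(1)] by (simp add: l2_inner_self norm_power power2_eq_square norm_mult)
  then show ?thesis using False by (simp add: mult_le_cancel_right less_le)
qed (use assms in simp)

lemma l2_norm_le_of_inner_self:
  assumes "u \<in> L2 M" "v \<in> L2 M" "l2_inner M u u = l2_inner M u v"
  shows "l2_norm M u \<le> l2_norm M v"
proof (cases "l2_norm M u = 0")
  case False
  have "l2_norm M u * l2_norm M u \<le> l2_norm M u * l2_norm M v"
    using l2_cauchy_schwarz[OF assms(1,2)]
    unfolding assms(3)[symmetric] l2_inner_self norm_of_real by (simp add: power2_eq_square)
  then show ?thesis using False by (simp add: mult_le_cancel_left less_le)
qed simp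

lemma l2_norm_add_le:
  assumes "u \<in> L2 M" "v \<in> L2 M"
  shows "l2_norm M (l2_add M u v) \<le> l2_norm M u + l2_norm M v"
proof (rule l2_norm_leI)
  fix w assume w: "w \<in> L2 M"
  have "cmod (l2_inner M w (l2_add M u v)) \<le> cmod (l2_inner M w u) + cmod (l2_inner M w v)"
    using assms w by (simp add: l2_inner_right norm_triangle_ineq)
  then show "cmod (l2_inner M w (l2_add M u v)) \<le> (l2_norm M u + l2_norm M v) * l2_norm M w"
    using l2_cauchy_schwarz[OF w assms(1)] l2_cauchy_schwarz[OF w assms(2)]
    by (simp add: algebra_simps)
qed (use assms in simp_all)

lemma l2_norm_scale:
  assumes "u \<in> L2 M" shows "l2_norm M (l2_scale M c u) = cmod c * l2_norm M u"
proof -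
  have "complex_of_real ((l2_norm M (l2_scale M c u))\<^sup>2) = of_real ((cmod c * l2_norm M u)\<^sup>2)"
    using assms by (simp only: l2_inner_self[symmetric] power_mult_distrib of_real_mult complex_norm_square)
      (simp add: l2_inner_right l2_inner_left)
  then have "(l2_norm M (l2_scale M c u))\<^sup>2 = (cmod c * l2_norm M u)\<^sup>2"
    by (simp only: of_real_eq_iff)
  then show ?thesis by (simp add: power2_eq_iff_nonneg)
qed

lemma l2_diff_conv_add:
  "u \<in> L2 M \<Longrightarrow> v \<in> L2 M \<Longrightarrow> l2_diff M u v = l2_add M u (l2_scale M (-1) v)"
  by (rule l2_eqI[where M = M]) (simp_all add: l2_inner_right)

section \<open>Bounded operators and adjoint pairs\<close>

lemma
  assumes "A \<in> bounded_ops M"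
  shows bounded_ops_closed: "u \<in> L2 M \<Longrightarrow> A u \<in> L2 M"
    and bounded_ops_undefined: "u \<notin> L2 M \<Longrightarrow> A u = undefined"
    and bounded_ops_add: "u \<in> L2 M \<Longrightarrow> v \<in> L2 M \<Longrightarrow> A (l2_add M u v) = l2_add M (A u) (A v)"
    and bounded_ops_scale: "u \<in> L2 M \<Longrightarrow> A (l2_scale M c u) = l2_scale M c (A u)"
  using assms by (auto simp: bounded_ops_def PiE_def extensional_def)

lemma bounded_ops_bound:
  assumes "A \<in> bounded_ops M"
  obtains C where "0 \<le> C" "\<And>u. u \<in> L2 M \<Longrightarrow> l2_norm M (A u) \<le> C * l2_norm M u"
proof -
  obtain C where C: "\<And>u. u \<in> L2 M \<Longrightarrow> l2_norm M (A u) \<le> C * l2_norm M u"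
    using assms unfolding bounded_ops_def by blast
  have "l2_norm M (A u) \<le> max C 0 * l2_norm M u" if "u \<in> L2 M" for u
    using C[OF that] mult_right_mono[of C "max C 0" "l2_norm M u"] by simp
  then show ?thesis by (intro that[of "max C 0"]) auto
qed

lemma bounded_ops_zero:
  assumes "A \<in> bounded_ops M" shows "A (l2_zero M) = l2_zero M"
proof -
  have [simp]: "l2_scale M 0 u = l2_zero M" if "u \<in> L2 M" for u
    using that by (intro l2_eqI[where M = M]) (simp_all add: l2_inner_right)
  show ?thesis
    using bounded_ops_scale[OF assms, of "l2_zero M" 0] bounded_ops_closed[OF assms] by simp
qed

lemma bounded_ops_diff:
  "A \<in> bounded_ops M \<Longrightarrow> u \<in> L2 M \<Longrightarrow> v \<in> L2 M \<Longrightarrow> A (l2_diff M u v) = l2_diff M (A u) (A v)"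
  by (simp add: l2_diff_conv_add bounded_ops_add bounded_ops_scale bounded_ops_closed)

text \<open>Linearity is asked for in the weak form in which operators given by finite sums or by
  adjoints satisfy it at once.\<close>

lemma bounded_opsI:
  assumes "A \<in> L2 M \<rightarrow>\<^sub>E L2 M"
    and "\<And>w u v. w \<in> L2 M \<Longrightarrow> u \<in> L2 M \<Longrightarrow> v \<in> L2 M \<Longrightarrow>
      l2_inner M w (A (l2_add M u v)) = l2_inner M w (A u) + l2_inner M w (A v)"
    and "\<And>w c u. w \<in> L2 M \<Longrightarrow> u \<in> L2 M \<Longrightarrow>
      l2_inner M w (A (l2_scale M c u)) = c * l2_inner M w (A u)"
    and "\<And>u. u \<in> L2 M \<Longrightarrow> l2_norm M (A u) \<le> C * l2_norm M u"
  shows "A \<in> bounded_ops M"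
proof -
  have [simp]: "A u \<in> L2 M" if "u \<in> L2 M" for u using assms(1) that by auto
  show ?thesis unfolding bounded_ops_def
    using assms(1,4)
    by (intro CollectI conjI ballI allI exI[of _ C] l2_eqI[where M = M])
      (simp_all add: assms(2,3) l2_inner_right)
qed

lemma op_comp_apply: "u \<in> L2 M \<Longrightarrow> op_comp M A B u = A (B u)"
  by (simp add: op_comp_def compose_def)

lemma op_comp_closed:
  assumes "A \<in> bounded_ops M" "B \<in> bounded_ops M"
  shows "op_comp M A B \<in> bounded_ops M"
proof -
  obtain C where C: "0 \<le> C" "\<And>u. u \<in> L2 M \<Longrightarrow> l2_norm M (A u) \<le> C * l2_norm M u"
    using bounded_ops_bound[OF assms(1)] by blast
  obtain D where D: "0 \<le> D" "\<And>u. u \<in> L2 M \<Longrightarrow> l2_norm M (B u) \<le> D * l2_norm M u"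
    using bounded_ops_bound[OF assms(2)] by blast
  note [simp] = bounded_ops_closed[OF assms(1)] bounded_ops_closed[OF assms(2)]
  show ?thesis
  proof (rule bounded_opsI[where C = "C * D"])
    fix u assume u: "u \<in> L2 M"
    have "l2_norm M (A (B u)) \<le> C * l2_norm M (B u)" using C(2) u by simp
    also have "\<dots> \<le> C * (D * l2_norm M u)" using C(1) D(2)[OF u] by (rule mult_left_mono[rotated])
    finally show "l2_norm M (op_comp M A B u) \<le> C * D * l2_norm M u"
      using u by (simp add: op_comp_apply mult.assoc)
  qed (auto simp: op_comp_apply bounded_ops_add[OF assms(1)] bounded_ops_add[OF assms(2)]
       bounded_ops_scale[OF assms(1)] bounded_ops_scale[OF assms(2)] l2_inner_right,
       auto simp: op_comp_def compose_def)
qed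

lemma op_comp_assoc:
  assumes "C \<in> bounded_ops M"
  shows "op_comp M (op_comp M A B) C = op_comp M A (op_comp M B C)"
  using bounded_ops_closed[OF assms] by (auto simp: op_comp_def compose_def fun_eq_iff)

lemma op_add_closed:
  assumes "A \<in> bounded_ops M" "B \<in> bounded_ops M"
  shows "op_add M A B \<in> bounded_ops M"
proof -
  obtain C where C: "0 \<le> C" "\<And>u. u \<in> L2 M \<Longrightarrow> l2_norm M (A u) \<le> C * l2_norm M u"
    using bounded_ops_bound[OF assms(1)] by blast
  obtain D where D: "0 \<le> D" "\<And>u. u \<in> L2 M \<Longrightarrow> l2_norm M (B u) \<le> D * l2_norm M u"
    using bounded_ops_bound[OF assms(2)] by blast
  note [simp] = bounded_ops_closed[OF assms(1)] bounded_ops_closed[OF assms(2)]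
  show ?thesis
  proof (rule bounded_opsI[where C = "C + D"])
    fix u assume u: "u \<in> L2 M"
    show "l2_norm M (op_add M A B u) \<le> (C + D) * l2_norm M u"
      using C(2)[OF u] D(2)[OF u] l2_norm_add_le[of "A u" M "B u"] u
      by (simp add: op_add_def distrib_right)
  qed (auto simp: op_add_def bounded_ops_add[OF assms(1)] bounded_ops_add[OF assms(2)]
       bounded_ops_scale[OF assms(1)] bounded_ops_scale[OF assms(2)] l2_inner_right algebra_simps)
qed

lemma op_scale_closed:
  assumes "A \<in> bounded_ops M"
  shows "op_scale M c A \<in> bounded_ops M"
proof -
  obtain C where C: "0 \<le> C" "\<And>u. u \<in> L2 M \<Longrightarrow> l2_norm M (A u) \<le> C * l2_norm M u"
    using bounded_ops_bound[OF assms(1)] by blast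
  note [simp] = bounded_ops_closed[OF assms(1)]
  show ?thesis
  proof (rule bounded_opsI[where C = "cmod c * C"])
    fix u assume u: "u \<in> L2 M"
    show "l2_norm M (op_scale M c A u) \<le> (cmod c * C) * l2_norm M u"
      using mult_left_mono[OF C(2)[OF u], of "cmod c"] u
      by (simp add: op_scale_def l2_norm_scale mult.assoc)
  qed (auto simp: op_scale_def bounded_ops_add[OF assms(1)]
       bounded_ops_scale[OF assms(1)] l2_inner_right algebra_simps)
qed

definition adjoint_pair :: "'x measure \<Rightarrow> 'x oper \<Rightarrow> 'x oper \<Rightarrow> bool" where
  "adjoint_pair M A B \<longleftrightarrow> A \<in> bounded_ops M \<and> B \<in> bounded_ops M \<and>
     (\<forall>u\<in>L2 M. \<forall>v\<in>L2 M. l2_inner M (A u) v = l2_inner M u (B v))"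

lemma adjoint_pair_sym: "adjoint_pair M A B \<Longrightarrow> adjoint_pair M B A"
  unfolding adjoint_pair_def using l2_inner_commute by metis

text \<open>An adjoint inherits linearity by nondegeneracy and boundedness, with the same constant, by
  duality, so that the identity between inner products is all that remains to be checked.\<close>

lemma adjoint_pairI:
  assumes A: "A \<in> bounded_ops M" and B: "B \<in> L2 M \<rightarrow>\<^sub>E L2 M"
    and AB: "\<And>u v. u \<in> L2 M \<Longrightarrow> v \<in> L2 M \<Longrightarrow> l2_inner M (A u) v = l2_inner M u (B v)"
  shows "adjoint_pair M A B"
proof -
  obtain C where C: "0 \<le> C" "\<And>u. u \<in> L2 M \<Longrightarrow> l2_norm M (A u) \<le> C * l2_norm M u"
    using bounded_ops_bound[OF A] by blast
  note [simp] = bounded_ops_closed[OF A]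
  have [simp]: "B v \<in> L2 M" if "v \<in> L2 M" for v using B that by auto
  have "B \<in> bounded_ops M"
  proof (rule bounded_opsI[OF B, where C = C])
    fix v assume v: "v \<in> L2 M"
    show "l2_norm M (B v) \<le> C * l2_norm M v"
    proof (rule l2_norm_leI)
      fix w assume w: "w \<in> L2 M"
      have "cmod (l2_inner M w (B v)) \<le> l2_norm M (A w) * l2_norm M v"
        using v w by (simp add: l2_cauchy_schwarz flip: AB)
      also have "\<dots> \<le> C * l2_norm M w * l2_norm M v"
        using C(2)[OF w] by (simp add: mult_right_mono)
      finally show "cmod (l2_inner M w (B v)) \<le> C * l2_norm M v * l2_norm M w"
        by (simp add: mult_ac)
    qed (use v C in simp_all)
  qed (simp_all add: l2_inner_right flip: AB)
  then show ?thesis using A AB by (simp add: adjoint_pair_def)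
qed

lemma op_adjoint_eq:
  assumes "adjoint_pair M A B" shows "op_adjoint M A = B"
  unfolding op_adjoint_def
proof (rule the_equality)
  fix D assume D: "D \<in> bounded_ops M \<and>
    (\<forall>u\<in>L2 M. \<forall>v\<in>L2 M. l2_inner M (A u) v = l2_inner M u (D v))"
  have B: "B \<in> bounded_ops M" using assms by (simp add: adjoint_pair_def)
  show "D = B"
  proof (rule ext)
    fix v show "D v = B v"
    proof (cases "v \<in> L2 M")
      case True
      then show ?thesis
        using D B assms by (intro l2_eqI) (auto simp: bounded_ops_closed adjoint_pair_def)
    next
      case False
      then show ?thesis using D B by (simp add: bounded_ops_undefined[where M = M])
    qed
  qed
qed (use assms in \<open>auto simp: adjoint_pair_def\<close>)

lemma conjugation_linear:
  assumes "V \<in> bounded_ops M" "W \<in> bounded_ops M" "\<A> \<subseteq> bounded_ops M"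
    and T: "\<And>A. T A = op_comp M W (op_comp M A V)" "T \<in> \<A> \<rightarrow> \<B>"
  shows "op_linear M \<A> \<B> T"
proof -
  have "T (op_add M A B) = op_add M (T A) (T B)"
    and "T (op_scale M c A) = op_scale M c (T A)" if "A \<in> \<A>" "B \<in> \<A>" for A B c
  proof -
    have "A \<in> bounded_ops M" "B \<in> bounded_ops M" using that assms(3) by auto
    then show "T (op_add M A B) = op_add M (T A) (T B)"
      "T (op_scale M c A) = op_scale M c (T A)"
      using assms(1,2) by (auto simp: fun_eq_iff T op_add_def op_scale_def op_comp_def compose_def
          bounded_ops_closed bounded_ops_add bounded_ops_scale)
  qed
  then show ?thesis using T(2) by (simp add: op_linear_def)
qed

text \<open>The easy direction of Stinespring's theorem, for one Kraus operator:
  \<open>\<Sum>\<^sub>i\<^sub>j \<langle>u\<^sub>i, W A\<^sub>i\<^sub>j V u\<^sub>j\<rangle> = \<Sum>\<^sub>i\<^sub>j \<langle>V u\<^sub>i, A\<^sub>i\<^sub>j V u\<^sub>j\<rangle>\<close>.\<close>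

lemma conjugation_completely_positive:
  assumes VW: "adjoint_pair M V W" and "\<A> \<subseteq> bounded_ops M"
    and T: "\<And>A. T A = op_comp M W (op_comp M A V)" "T \<in> \<A> \<rightarrow> \<B>"
  shows "completely_positive M \<A> \<B> T"
proof -
  have V: "V \<in> bounded_ops M" and W: "W \<in> bounded_ops M"
    and adj: "\<And>u v. u \<in> L2 M \<Longrightarrow> v \<in> L2 M \<Longrightarrow> l2_inner M u (W v) = l2_inner M (V u) v"
    using VW by (auto simp: adjoint_pair_def)
  have "op_matrix_positive M n (\<lambda>i j. T (A i j))" if A: "op_matrix_positive M n A" for n A
  proof -
    have A_bounded: "A i j \<in> bounded_ops M" if "i < n" "j < n" for i j
      using A that by (auto simp: op_matrix_positive_def op_matrices_def)
    have "0 \<le> (\<Sum>i<n. \<Sum>j<n. l2_inner M (u i) (T (A i j) (u j)))"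
      if u: "\<And>i. i < n \<Longrightarrow> u i \<in> L2 M" for u
    proof -
      have "0 \<le> (\<Sum>i<n. \<Sum>j<n. l2_inner M (V (u i)) (A i j (V (u j))))"
        using A bounded_ops_closed[OF V] u by (simp add: op_matrix_positive_def)
      also have "\<dots> = (\<Sum>i<n. \<Sum>j<n. l2_inner M (u i) (T (A i j) (u j)))"
        using u by (intro sum.cong refl)
          (simp add: T op_comp_apply adj bounded_ops_closed[OF A_bounded] bounded_ops_closed[OF V])
      finally show ?thesis .
    qed
    then show ?thesis
      using A_bounded V W by (simp add: op_matrix_positive_def op_matrices_def T op_comp_closed)
  qed
  then show ?thesis
    using conjugation_linear[OF V W assms(2) T] by (simp add: completely_positive_def)
qed

lemma completely_positive_imp_positive:
  assumes "completely_positive M \<A> \<B> T" "A \<in> \<A>" "op_positive M A"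
  shows "op_positive M (T A)"
proof -
  have "op_matrix_positive M 1 (\<lambda>i j. A)"
    using assms(3) by (simp add: op_matrix_positive_def op_matrices_def op_positive_def)
  then have *: "op_matrix_positive M 1 (\<lambda>i j. T A)"
    using assms(1,2) by (fastforce simp: completely_positive_def op_matrices_def)
  have "0 \<le> l2_inner M u (T A u)" if "u \<in> L2 M" for u
    using * that unfolding op_matrix_positive_def by (auto dest: spec[of _ "\<lambda>_. u"])
  then show ?thesis
    using * by (simp add: op_positive_def op_matrix_positive_def op_matrices_def)
qed


section \<open>Orthonormal families and projections onto their spans\<close>

primrec l2_comb :: "'x measure \<Rightarrow> (nat \<Rightarrow> 'x cls) \<Rightarrow> (nat \<Rightarrow> complex) \<Rightarrow> nat \<Rightarrow> 'x cls" where
  "l2_comb M \<phi> c 0 = l2_zero M"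
| "l2_comb M \<phi> c (Suc n) = l2_add M (l2_comb M \<phi> c n) (l2_scale M (c n) (\<phi> n))"

locale orthonormal_family =
  fixes M :: "'x measure" and \<phi> :: "nat \<Rightarrow> 'x cls"
  assumes phi_L2 [simp]: "\<phi> j \<in> L2 M"
    and inner_phi: "l2_inner M (\<phi> i) (\<phi> j) = (if i = j then 1 else 0)"
begin

lemma comb_L2 [simp]: "l2_comb M \<phi> c n \<in> L2 M"
  by (induction n) auto

lemma inner_comb_right:
  "u \<in> L2 M \<Longrightarrow> l2_inner M u (l2_comb M \<phi> c n) = (\<Sum>j<n. c j * l2_inner M u (\<phi> j))"
  by (induction n) (simp_all add: l2_inner_right)

lemma inner_comb_left:
  "u \<in> L2 M \<Longrightarrow> l2_inner M (l2_comb M \<phi> c n) u = (\<Sum>j<n. cnj (c j) * l2_inner M (\<phi> j) u)"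
  by (induction n) (simp_all add: l2_inner_left)

lemma inner_bounded_op_comb:
  assumes "A \<in> bounded_ops M" "u \<in> L2 M"
  shows "l2_inner M u (A (l2_comb M \<phi> c n)) = (\<Sum>j<n. c j * l2_inner M u (A (\<phi> j)))"
  by (induction n) (simp_all add: assms bounded_ops_closed[OF assms(1)] bounded_ops_zero[OF assms(1)]
      bounded_ops_add[OF assms(1)] bounded_ops_scale[OF assms(1)] l2_inner_right)

lemma inner_phi_comb: "j < n \<Longrightarrow> l2_inner M (\<phi> j) (l2_comb M \<phi> c n) = c j"
  by (simp add: inner_comb_right inner_phi if_distrib sum.delta cong: if_cong)

lemma comb_cong: "(\<And>j. j < n \<Longrightarrow> c j = d j) \<Longrightarrow> l2_comb M \<phi> c n = l2_comb M \<phi> d n"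
  by (induction n) simp_all

lemma subspace_combs: "l2_subspace M (range (\<lambda>c. l2_comb M \<phi> c n))"
proof -
  have "l2_zero M = l2_comb M \<phi> (\<lambda>_. 0) n"
    by (rule l2_eqI[where M = M]) (simp_all add: inner_comb_right l2_inner_right)
  moreover have "l2_add M (l2_comb M \<phi> c n) (l2_comb M \<phi> d n) = l2_comb M \<phi> (\<lambda>j. c j + d j) n" for c d
    by (rule l2_eqI[where M = M]) (simp_all add: inner_comb_right l2_inner_right distrib_right sum.distrib)
  moreover have "l2_scale M a (l2_comb M \<phi> c n) = l2_comb M \<phi> (\<lambda>j. a * c j) n" for a c
    by (rule l2_eqI[where M = M]) (simp_all add: inner_comb_right l2_inner_right sum_distrib_left mult.assoc)
  ultimately show ?thesis by (auto simp: l2_subspace_def)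
qed

lemma HL_eq: "HL M \<phi> L = range (\<lambda>c. l2_comb M \<phi> c L)"
  unfolding HL_def l2_span_def
proof (rule hull_unique)
  show "\<phi> ` {..<L} \<subseteq> range (\<lambda>c. l2_comb M \<phi> c L)"
  proof (intro image_subsetI)
    fix j assume "j \<in> {..<L}"
    then have "\<phi> j = l2_comb M \<phi> (\<lambda>i. if i = j then 1 else 0) L"
      by (intro l2_eqI[where M = M])
        (simp_all add: inner_comb_right if_distrib[where f = "\<lambda>z. z * _"] sum.delta cong: if_cong)
    then show "\<phi> j \<in> range (\<lambda>c. l2_comb M \<phi> c L)" by blast
  qed
  show "l2_subspace M (range (\<lambda>c. l2_comb M \<phi> c L))" by (rule subspace_combs)
next
  fix V assume V: "\<phi> ` {..<L} \<subseteq> V" "l2_subspace M V"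
  have "n \<le> L \<Longrightarrow> l2_comb M \<phi> c n \<in> V" for c n
    using V by (induction n) (auto simp: l2_subspace_def image_subset_iff)
  then show "range (\<lambda>c. l2_comb M \<phi> c L) \<subseteq> V" by auto
qed

lemma phi_HL: "j < L \<Longrightarrow> \<phi> j \<in> HL M \<phi> L"
  unfolding HL_def l2_span_def by (rule hull_inc) simp

lemma perp_HL: "u \<in> l2_perp M (HL M \<phi> L) \<longleftrightarrow> u \<in> L2 M \<and> (\<forall>j<L. l2_inner M (\<phi> j) u = 0)"
proof
  assume "u \<in> l2_perp M (HL M \<phi> L)"
  then show "u \<in> L2 M \<and> (\<forall>j<L. l2_inner M (\<phi> j) u = 0)"
    using phi_HL by (auto simp: l2_perp_def)
next
  assume u: "u \<in> L2 M \<and> (\<forall>j<L. l2_inner M (\<phi> j) u = 0)"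
  then show "u \<in> l2_perp M (HL M \<phi> L)"
    by (auto simp: l2_perp_def HL_eq inner_comb_left)
qed

text \<open>Orthogonality of \<open>u - v\<close> to every \<open>\<phi>\<^sub>j\<close> forces the coefficients of \<open>v \<in> H\<^sub>L\<close> to be the
  Fourier coefficients of \<open>u\<close>, so existence and uniqueness of the projection are elementary.\<close>

lemma PiL_apply:
  assumes u: "u \<in> L2 M"
  shows "PiL M \<phi> L u = l2_comb M \<phi> (\<lambda>j. l2_inner M (\<phi> j) u) L"
proof -
  have "(THE v. v \<in> HL M \<phi> L \<and> l2_diff M u v \<in> l2_perp M (HL M \<phi> L)) =
    l2_comb M \<phi> (\<lambda>j. l2_inner M (\<phi> j) u) L" (is "_ = ?p")
  proof (rule the_equality)
    show "?p \<in> HL M \<phi> L \<and> l2_diff M u ?p \<in> l2_perp M (HL M \<phi> L)"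
      using u by (auto simp: perp_HL l2_inner_right inner_phi_comb) (auto simp: HL_eq)
  next
    fix v assume v: "v \<in> HL M \<phi> L \<and> l2_diff M u v \<in> l2_perp M (HL M \<phi> L)"
    then obtain c where c: "v = l2_comb M \<phi> c L" by (auto simp: HL_eq)
    show "v = ?p" unfolding c
    proof (rule comb_cong)
      fix j assume "j < L"
      then show "c j = l2_inner M (\<phi> j) u"
        using v u by (simp add: perp_HL c l2_inner_right inner_phi_comb)
    qed
  qed
  then show ?thesis using u by (simp add: PiL_def orth_proj_def)
qed

lemma PiL_HL: "u \<in> L2 M \<Longrightarrow> PiL M \<phi> L u \<in> HL M \<phi> L"
  by (simp add: PiL_apply HL_eq)

lemma PiL_L2 [simp]: "u \<in> L2 M \<Longrightarrow> PiL M \<phi> L u \<in> L2 M"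
  by (simp add: PiL_apply)

lemma PiL_id_on_HL: "u \<in> HL M \<phi> L \<Longrightarrow> PiL M \<phi> L u = u"
  unfolding HL_eq by (elim rangeE) (simp add: PiL_apply, rule comb_cong, rule inner_phi_comb)

lemma diff_PiL_perp: "u \<in> L2 M \<Longrightarrow> l2_diff M u (PiL M \<phi> L u) \<in> l2_perp M (HL M \<phi> L)"
  by (simp add: perp_HL l2_inner_right PiL_apply inner_phi_comb)

lemma inner_PiL_right:
  assumes "u \<in> L2 M" "v \<in> L2 M"
  shows "l2_inner M u (PiL M \<phi> L v) = (\<Sum>j<L. l2_inner M u (\<phi> j) * l2_inner M (\<phi> j) v)"
  using assms by (simp add: PiL_apply inner_comb_right mult.commute)

lemma PiL_self_adjoint:
  assumes "u \<in> L2 M" "v \<in> L2 M"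
  shows "l2_inner M (PiL M \<phi> L u) v = l2_inner M u (PiL M \<phi> L v)"
proof -
  have "l2_inner M u (\<phi> j) = cnj (l2_inner M (\<phi> j) u)" for j by (rule l2_inner_commute)
  then show ?thesis using assms by (simp add: PiL_apply inner_comb_left inner_comb_right mult.commute)
qed

lemma PiL_contraction:
  assumes u: "u \<in> L2 M" shows "l2_norm M (PiL M \<phi> L u) \<le> l2_norm M u"
proof (rule l2_norm_le_of_inner_self)
  show "l2_inner M (PiL M \<phi> L u) (PiL M \<phi> L u) = l2_inner M (PiL M \<phi> L u) u"
    using u by (simp add: PiL_self_adjoint PiL_id_on_HL PiL_HL)
qed (use u in simp_all)

lemma PiL_bounded: "PiL M \<phi> L \<in> bounded_ops M"
proof (rule bounded_opsI[where C = 1])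
  show "PiL M \<phi> L \<in> L2 M \<rightarrow>\<^sub>E L2 M"
    by (rule PiE_I) (simp_all, simp add: PiL_def orth_proj_def)
qed (simp_all add: inner_PiL_right l2_inner_right distrib_left sum.distrib sum_distrib_left
    mult.left_commute PiL_contraction)

lemma PiL_adjoint_pair: "adjoint_pair M (PiL M \<phi> L) (PiL M \<phi> L)"
  using PiL_self_adjoint by (simp add: adjoint_pair_def PiL_bounded)

section \<open>The matrix algebra $B(H_L)$\<close>

lemma
  assumes "A \<in> BL M \<phi> L"
  shows BL_bounded: "A \<in> bounded_ops M"
    and BL_range: "u \<in> L2 M \<Longrightarrow> A u \<in> HL M \<phi> L"
    and BL_kernel: "u \<in> l2_perp M (HL M \<phi> L) \<Longrightarrow> A u = l2_zero M"
  using assms by (auto simp: BL_def)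

lemma PiL_BL: "PiL M \<phi> L \<in> BL M \<phi> L"
proof -
  have "PiL M \<phi> L u = l2_zero M" if "u \<in> l2_perp M (HL M \<phi> L)" for u
  proof -
    have u: "u \<in> L2 M" "\<forall>j<L. l2_inner M (\<phi> j) u = 0" using that by (simp_all add: perp_HL)
    then show ?thesis
      by (intro l2_eqI[where M = M]) (simp_all add: inner_PiL_right l2_inner_right)
  qed
  then show ?thesis by (simp add: BL_def PiL_bounded PiL_HL)
qed

text \<open>An element of \<open>B\<^sub>L\<close> kills \<open>u - \<Pi>\<^sub>L u\<close>. It is therefore determined by its values on \<open>H\<^sub>L\<close>, that
  is, by finitely many vectors.\<close>

lemma BL_apply_PiL:
  assumes A: "A \<in> BL M \<phi> L" and u: "u \<in> L2 M"
  shows "A (PiL M \<phi> L u) = A u"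
proof (rule l2_eqI[where M = M])
  note [simp] = bounded_ops_closed[OF BL_bounded[OF A]]
  have "l2_diff M (A u) (A (PiL M \<phi> L u)) = l2_zero M"
    using BL_kernel[OF A diff_PiL_perp[OF u]] u by (simp add: bounded_ops_diff[OF BL_bounded[OF A]])
  then have "l2_inner M w (l2_diff M (A u) (A (PiL M \<phi> L u))) = 0" if "w \<in> L2 M" for w
    using that by (simp add: l2_inner_right)
  then show "l2_inner M w (A (PiL M \<phi> L u)) = l2_inner M w (A u)" if "w \<in> L2 M" for w
    using that u by (simp add: l2_inner_right)
qed (use u bounded_ops_closed[OF BL_bounded[OF A]] in simp_all)

lemma conjugation_BL:
  assumes "U \<in> BL M \<phi> L" "A \<in> bounded_ops M" "V \<in> BL M \<phi> L"
  shows "op_comp M U (op_comp M A V) \<in> BL M \<phi> L"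
proof -
  note U = BL_bounded[OF assms(1)] and V = BL_bounded[OF assms(3)]
  have "op_comp M U (op_comp M A V) u = l2_zero M" if "u \<in> l2_perp M (HL M \<phi> L)" for u
  proof -
    have "u \<in> L2 M" using that by (simp add: l2_perp_def)
    then show ?thesis using BL_kernel[OF assms(3) that]
      by (simp add: op_comp_apply bounded_ops_zero[OF U] bounded_ops_zero[OF assms(2)])
  qed
  moreover have "op_comp M U (op_comp M A V) u \<in> HL M \<phi> L" if "u \<in> L2 M" for u
    using that by (simp add: op_comp_apply BL_range[OF assms(1)] bounded_ops_closed[OF V] bounded_ops_closed[OF assms(2)])
  ultimately show ?thesis using U V assms(2) by (simp add: BL_def op_comp_closed)
qed

lemma comp_BL:
  assumes "A \<in> BL M \<phi> L" "B \<in> BL M \<phi> L"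
  shows "op_comp M A B \<in> BL M \<phi> L"
proof -
  have "op_comp M A B u = l2_zero M" if "u \<in> l2_perp M (HL M \<phi> L)" for u
  proof -
    have "u \<in> L2 M" using that by (simp add: l2_perp_def)
    then show ?thesis using BL_kernel[OF assms(2) that]
      by (simp add: op_comp_apply bounded_ops_zero[OF BL_bounded[OF assms(1)]])
  qed
  moreover have "op_comp M A B u \<in> HL M \<phi> L" if "u \<in> L2 M" for u
    using that by (simp add: op_comp_apply BL_range[OF assms(1)] bounded_ops_closed[OF BL_bounded[OF assms(2)]])
  ultimately show ?thesis using assms by (simp add: BL_def op_comp_closed)
qed

lemma op_PiL_BL: "A \<in> bounded_ops M \<Longrightarrow> op_PiL M \<phi> L A \<in> BL M \<phi> L"
  unfolding op_PiL_def by (intro conjugation_BL PiL_BL)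

lemma op_PiL_completely_positive:
  "completely_positive M (bounded_ops M) (BL M \<phi> L) (op_PiL M \<phi> L)"
  by (rule conjugation_completely_positive[OF PiL_adjoint_pair[of L]])
    (auto simp: op_PiL_def[abs_def] op_PiL_BL[unfolded op_PiL_def])

text \<open>Expanding \<open>A u = A (\<Pi>\<^sub>L u) = \<Sum>\<^sub>j \<langle>\<phi>\<^sub>j, u\<rangle> A \<phi>\<^sub>j\<close> shows what the adjoint must be:
  \<open>A\<^sup>* v = \<Sum>\<^sub>j \<langle>A \<phi>\<^sub>j, v\<rangle> \<phi>\<^sub>j\<close>.\<close>

lemma BL_has_adjoint:
  assumes A: "A \<in> BL M \<phi> L"
  obtains B where "B \<in> BL M \<phi> L" "adjoint_pair M A B"
proof
  define B where "B = (\<lambda>v\<in>L2 M. l2_comb M \<phi> (\<lambda>j. l2_inner M (A (\<phi> j)) v) L)"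
  note Ab = BL_bounded[OF A]
  show AB: "adjoint_pair M A B"
  proof (rule adjoint_pairI[OF Ab])
    show "B \<in> L2 M \<rightarrow>\<^sub>E L2 M" by (simp add: B_def)
    fix u v assume uv: "u \<in> L2 M" "v \<in> L2 M"
    have flip: "l2_inner M v (A w) = cnj (l2_inner M (A w) v)"
      "l2_inner M u w = cnj (l2_inner M w u)" for w
      by (rule l2_inner_commute)+
    have "l2_inner M (A u) v = cnj (l2_inner M v (A (PiL M \<phi> L u)))"
      unfolding BL_apply_PiL[OF A uv(1)] by (rule l2_inner_commute)
    also have "\<dots> = cnj (\<Sum>j<L. l2_inner M (\<phi> j) u * l2_inner M v (A (\<phi> j)))"
      using uv by (simp add: PiL_apply inner_bounded_op_comb[OF Ab])
    also have "\<dots> = (\<Sum>j<L. l2_inner M (A (\<phi> j)) v * l2_inner M u (\<phi> j))"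
      by (simp add: flip mult.commute)
    also have "\<dots> = l2_inner M u (B v)"
      using uv by (simp add: B_def inner_comb_right)
    finally show "l2_inner M (A u) v = l2_inner M u (B v)" .
  qed
  have "B v = l2_zero M" if "v \<in> l2_perp M (HL M \<phi> L)" for v
  proof -
    have v: "v \<in> L2 M" "\<And>u. u \<in> HL M \<phi> L \<Longrightarrow> l2_inner M u v = 0"
      using that by (simp_all add: l2_perp_def)
    then have "B v = l2_comb M \<phi> (\<lambda>j. 0) L"
      by (simp add: B_def BL_range[OF A])
    then show ?thesis
      by (intro l2_eqI[where M = M]) (simp_all add: inner_comb_right l2_inner_right)
  qed
  moreover have "B v \<in> HL M \<phi> L" if "v \<in> L2 M" for v
    using that by (simp add: B_def HL_eq)
  ultimately show "B \<in> BL M \<phi> L" using AB by (simp add: BL_def adjoint_pair_def)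
qed

text \<open>The trace of a matrix product: since \<open>B \<phi>\<^sub>j\<close> lies in \<open>H\<^sub>L\<close>, it is the sum of its components
  along the \<open>\<phi>\<^sub>k\<close>.\<close>

lemma trace_comp:
  assumes "A \<in> BL M \<phi> L" "B \<in> BL M \<phi> L"
  shows "HL_trace M \<phi> L (op_comp M A B) =
    (\<Sum>j<L. \<Sum>k<L. l2_inner M (\<phi> k) (B (\<phi> j)) * l2_inner M (\<phi> j) (A (\<phi> k)))"
  unfolding HL_trace_def
proof (intro sum.cong refl)
  fix j
  have "B (\<phi> j) = PiL M \<phi> L (B (\<phi> j))"
    by (simp add: PiL_id_on_HL BL_range[OF assms(2)])
  also have "\<dots> = l2_comb M \<phi> (\<lambda>k. l2_inner M (\<phi> k) (B (\<phi> j))) L"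
    by (simp add: PiL_apply bounded_ops_closed[OF BL_bounded[OF assms(2)]])
  finally have Bj: "B (\<phi> j) = l2_comb M \<phi> (\<lambda>k. l2_inner M (\<phi> k) (B (\<phi> j))) L" .
  have "l2_inner M (\<phi> j) (op_comp M A B (\<phi> j)) = l2_inner M (\<phi> j) (A (B (\<phi> j)))"
    by (simp add: op_comp_apply)
  also have "\<dots> = (\<Sum>k<L. l2_inner M (\<phi> k) (B (\<phi> j)) * l2_inner M (\<phi> j) (A (\<phi> k)))"
    by (subst Bj) (simp add: inner_bounded_op_comb[OF BL_bounded[OF assms(1)]])
  finally show "l2_inner M (\<phi> j) (op_comp M A B (\<phi> j)) = \<dots>" .
qed

lemma trace_cyclic:
  assumes "A \<in> BL M \<phi> L" "B \<in> BL M \<phi> L"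
  shows "HL_trace M \<phi> L (op_comp M A B) = HL_trace M \<phi> L (op_comp M B A)"
  unfolding trace_comp[OF assms] trace_comp[OF assms(2,1)]
  by (subst sum.swap) (simp add: mult.commute)

text \<open>With \<open>p = \<Pi>\<^sub>L u\<close> the quadratic form of \<open>\<Pi>\<^sub>L - U V\<close> at \<open>u\<close> is \<open>\<parallel>p\<parallel>\<^sup>2 - \<parallel>V p\<parallel>\<^sup>2\<close>, and the adjoint \<open>V\<close> of the
  contraction \<open>U\<close> is a contraction.\<close>

lemma projection_minus_conjugate_positive:
  assumes U: "U \<in> BL M \<phi> L" and V: "V \<in> BL M \<phi> L" and adj: "adjoint_pair M U V"
    and contr: "\<And>u. u \<in> L2 M \<Longrightarrow> l2_norm M (U u) \<le> l2_norm M u"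
  shows "op_positive M (op_add M (PiL M \<phi> L) (op_scale M (-1) (op_comp M U V)))"
proof -
  note [simp] = bounded_ops_closed[OF BL_bounded[OF U]] bounded_ops_closed[OF BL_bounded[OF V]]
  have UV: "l2_inner M u (U v) = l2_inner M (V u) v" if "u \<in> L2 M" "v \<in> L2 M" for u v
    using adjoint_pair_sym[OF adj] that by (simp add: adjoint_pair_def)
  have V_contr: "l2_norm M (V u) \<le> l2_norm M u" if u: "u \<in> L2 M" for u
  proof (rule l2_norm_leI)
    fix w assume w: "w \<in> L2 M"
    have "l2_inner M w (V u) = l2_inner M (U w) u" using u w adj by (simp add: adjoint_pair_def)
    also have "cmod \<dots> \<le> l2_norm M (U w) * l2_norm M u" using u w by (simp add: l2_cauchy_schwarz)
    also have "\<dots> \<le> l2_norm M u * l2_norm M w" using contr[OF w] by (simp add: mult_left_mono mult.commute)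
    finally show "cmod (l2_inner M w (V u)) \<le> l2_norm M u * l2_norm M w" .
  qed (use u in simp_all)
  have "0 \<le> l2_inner M u (op_add M (PiL M \<phi> L) (op_scale M (-1) (op_comp M U V)) u)"
    if u: "u \<in> L2 M" for u
  proof -
    let ?p = "PiL M \<phi> L u"
    have "l2_inner M u (op_add M (PiL M \<phi> L) (op_scale M (-1) (op_comp M U V)) u) =
      l2_inner M u ?p - l2_inner M u (U (V u))"
      using u by (simp add: op_add_def op_scale_def op_comp_apply l2_inner_right)
    also have "l2_inner M u ?p = l2_inner M ?p ?p"
      using u by (simp add: PiL_self_adjoint PiL_id_on_HL PiL_HL)
    also have "l2_inner M u (U (V u)) = l2_inner M (V ?p) (V ?p)"
      using u by (simp add: UV BL_apply_PiL[OF V])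
    also have "l2_inner M ?p ?p - l2_inner M (V ?p) (V ?p) =
        of_real ((l2_norm M ?p)\<^sup>2 - (l2_norm M (V ?p))\<^sup>2)"
      by (simp add: l2_inner_self)
    also have "0 \<le> \<dots>"
      using V_contr[of ?p] u unfolding less_eq_complex_def by (simp add: power_mono)
    finally show ?thesis .
  qed
  moreover have "op_add M (PiL M \<phi> L) (op_scale M (-1) (op_comp M U V)) \<in> bounded_ops M"
    by (intro op_add_closed op_scale_closed op_comp_closed PiL_bounded BL_bounded[OF U] BL_bounded[OF V])
  ultimately show ?thesis by (simp add: op_positive_def)
qed

lemma PiL_minus_BL:
  assumes A: "A \<in> BL M \<phi> L"
  shows "op_add M (PiL M \<phi> L) (op_scale M (-1) A) \<in> BL M \<phi> L" (is "?D \<in> _")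
proof -
  note [simp] = bounded_ops_closed[OF BL_bounded[OF A]]
  have "?D u = l2_zero M" if u: "u \<in> l2_perp M (HL M \<phi> L)" for u
  proof -
    have "u \<in> L2 M" using u by (simp add: l2_perp_def)
    then show ?thesis
      using BL_kernel[OF A u] BL_kernel[OF PiL_BL u]
      by (intro l2_eqI[where M = M]) (simp_all add: op_add_def op_scale_def l2_inner_right)
  qed
  moreover have "?D u \<in> HL M \<phi> L" if "u \<in> L2 M" for u
    using that BL_range[OF A that] PiL_HL[OF that] subspace_combs[of L, folded HL_eq]
    unfolding l2_subspace_def by (simp add: op_add_def op_scale_def)
  moreover have "?D \<in> bounded_ops M"
    by (intro op_add_closed op_scale_closed PiL_bounded BL_bounded[OF A])
  ultimately show ?thesis by (simp add: BL_def)
qed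

lemma trace_comp_PiL_minus:
  assumes "\<rho> \<in> BL M \<phi> L" "A \<in> BL M \<phi> L"
  shows "HL_trace M \<phi> L (op_comp M \<rho> (op_add M (PiL M \<phi> L) (op_scale M (-1) A))) =
    HL_trace M \<phi> L (op_comp M \<rho> (PiL M \<phi> L)) - HL_trace M \<phi> L (op_comp M \<rho> A)"
proof -
  note [simp] = bounded_ops_closed[OF BL_bounded[OF assms(1)]] bounded_ops_closed[OF BL_bounded[OF assms(2)]]
  show ?thesis
    by (simp add: HL_trace_def op_comp_apply op_add_def op_scale_def l2_inner_right sum_subtractf
        bounded_ops_add[OF BL_bounded[OF assms(1)]] bounded_ops_scale[OF BL_bounded[OF assms(1)]])
qed

text \<open>The map of preduals is \<open>\<sigma> \<mapsto> V \<sigma> U\<close>, by cyclicity of the trace; the bound at the unit is the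
  value of the state at the positive operator \<open>\<Pi>\<^sub>L - U V\<close>.\<close>

lemma contraction_conjugation_quantum_operation:
  assumes U: "U \<in> BL M \<phi> L" and V: "V \<in> BL M \<phi> L" and adj: "adjoint_pair M U V"
    and contr: "\<And>u. u \<in> L2 M \<Longrightarrow> l2_norm M (U u) \<le> l2_norm M u"
    and T: "\<And>A. T A = op_comp M U (op_comp M A V)"
  shows "quantum_operation M (BL_algebra M \<phi> L) (BL_algebra M \<phi> L) T"
proof -
  let ?tr = "HL_trace M \<phi> L"
  note Ub = BL_bounded[OF U] and Vb = BL_bounded[OF V]
  have BL_sub: "BL M \<phi> L \<subseteq> bounded_ops M" by (auto simp: BL_def)
  define Tp where "Tp \<sigma> = op_comp M V (op_comp M \<sigma> U)" for \<sigma>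
  have CP: "completely_positive M (BL M \<phi> L) (BL M \<phi> L) T"
    by (rule conjugation_completely_positive[OF adjoint_pair_sym[OF adj] BL_sub T])
      (simp add: T conjugation_BL U V BL_bounded)
  have Tp_BL: "Tp \<in> BL M \<phi> L \<rightarrow> BL M \<phi> L"
    by (simp add: Tp_def conjugation_BL U V BL_bounded)
  have lin: "op_linear M (BL M \<phi> L) (BL M \<phi> L) Tp"
    by (rule conjugation_linear[OF Ub Vb BL_sub Tp_def Tp_BL])
  have dual: "?tr (op_comp M \<rho> (T A)) = ?tr (op_comp M (Tp \<rho>) A)"
    if \<rho>: "\<rho> \<in> BL M \<phi> L" and A: "A \<in> BL M \<phi> L" for \<rho> A
  proof -
    note b = Ub Vb BL_bounded[OF \<rho>] BL_bounded[OF A]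
    have "op_comp M \<rho> (T A) = op_comp M (op_comp M \<rho> (op_comp M U A)) V"
      by (simp add: T op_comp_assoc b op_comp_closed)
    then have "?tr (op_comp M \<rho> (T A)) = ?tr (op_comp M V (op_comp M \<rho> (op_comp M U A)))"
      by (simp add: trace_cyclic comp_BL U V \<rho> A)
    also have "op_comp M V (op_comp M \<rho> (op_comp M U A)) = op_comp M (Tp \<rho>) A"
      by (simp add: Tp_def op_comp_assoc b op_comp_closed)
    finally show ?thesis .
  qed
  have "?tr (op_comp M (Tp \<rho>) (PiL M \<phi> L)) \<le> 1"
    if \<rho>: "\<rho> \<in> BL M \<phi> L" and unit: "?tr (op_comp M \<rho> (PiL M \<phi> L)) = 1"
      and pos: "\<And>A. A \<in> BL M \<phi> L \<Longrightarrow> op_positive M A \<Longrightarrow> 0 \<le> ?tr (op_comp M \<rho> A)" for \<rho>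
  proof -
    have UV: "op_comp M U V \<in> BL M \<phi> L" by (rule comp_BL[OF U V])
    \<comment> \<open>the unit of the algebra is \<open>\<Pi>\<^sub>L\<close>, which is absorbed by \<open>V\<close>\<close>
    have "T (PiL M \<phi> L) = op_comp M U V"
      using PiL_id_on_HL BL_range[OF V] by (auto simp: T op_comp_def compose_def fun_eq_iff)
    then have "?tr (op_comp M (Tp \<rho>) (PiL M \<phi> L)) = ?tr (op_comp M \<rho> (op_comp M U V))"
      using dual[OF \<rho> PiL_BL] by simp
    moreover have "0 \<le> 1 - ?tr (op_comp M \<rho> (op_comp M U V))"
      using pos[OF PiL_minus_BL[OF UV] projection_minus_conjugate_positive[OF U V adj contr]]
      by (simp add: trace_comp_PiL_minus[OF \<rho> UV] unit)
    ultimately show ?thesis by (simp add: less_eq_complex_def)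
  qed
  then show ?thesis
    using CP lin dual unfolding quantum_operation_def normal_state_def BL_algebra_def by auto
qed

end

section \<open>Multiplication operators and the Koopman operator\<close>

lemma rep_Linf:
  assumes "a \<in> Linf M"
  obtains C where "rep a \<in> borel_measurable M" "AE x in M. cmod (rep a x) \<le> C"
proof -
  obtain f C where f: "a = ae_class M f" "f \<in> borel_measurable M" "AE x in M. cmod (f x) \<le> C"
    using assms by (auto simp: Linf_def)
  have "AE x in M. cmod (rep a x) \<le> C"
    using f(3) rep_ae_class_AE[OF f(2)] unfolding f(1) by eventually_elim simp
  then show ?thesis using that rep_ae_class_measurable[OF f(2)] f(1) by blast
qed

lemma square_integrable_mult:
  assumes [measurable]: "g \<in> borel_measurable M" and C: "AE x in M. cmod (g x) \<le> C"
    and f: "square_integrable M f"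
  shows "square_integrable M (\<lambda>x. g x * f x)"
    and "sqrt (\<integral>x. (cmod (g x * f x))\<^sup>2 \<partial>M) \<le> \<bar>C\<bar> * sqrt (\<integral>x. (cmod (f x))\<^sup>2 \<partial>M)"
proof -
  have [measurable]: "f \<in> borel_measurable M" using f by (simp add: square_integrable_def)
  have int: "integrable M (\<lambda>x. C\<^sup>2 * (cmod (f x))\<^sup>2)" using f by (simp add: square_integrable_def)
  have le: "AE x in M. (cmod (g x * f x))\<^sup>2 \<le> C\<^sup>2 * (cmod (f x))\<^sup>2"
    using C by eventually_elim (simp add: norm_mult power_mult_distrib mult_right_mono power_mono)
  have int': "integrable M (\<lambda>x. (cmod (g x * f x))\<^sup>2)"
    by (rule Bochner_Integration.integrable_bound[OF int]) (use le in auto)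
  then show "square_integrable M (\<lambda>x. g x * f x)" by (simp add: square_integrable_def)
  have "(\<integral>x. (cmod (g x * f x))\<^sup>2 \<partial>M) \<le> (\<integral>x. C\<^sup>2 * (cmod (f x))\<^sup>2 \<partial>M)"
    by (rule integral_mono_AE[OF int' int le])
  then have "sqrt (\<integral>x. (cmod (g x * f x))\<^sup>2 \<partial>M) \<le> sqrt (C\<^sup>2 * (\<integral>x. (cmod (f x))\<^sup>2 \<partial>M))"
    by simp
  then show "sqrt (\<integral>x. (cmod (g x * f x))\<^sup>2 \<partial>M) \<le> \<bar>C\<bar> * sqrt (\<integral>x. (cmod (f x))\<^sup>2 \<partial>M)"
    by (simp add: real_sqrt_mult)
qed

lemma l2_norm_ae_class:
  assumes f: "square_integrable M f"
  shows "l2_norm M (ae_class M f) = sqrt (\<integral>x. (cmod (f x))\<^sup>2 \<partial>M)"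
proof -
  have [measurable]: "f \<in> borel_measurable M" using f by (simp add: square_integrable_def)
  note [measurable] = rep_ae_class_measurable[of f M]
  have "(\<integral>x. (cmod (rep (ae_class M f) x))\<^sup>2 \<partial>M) = (\<integral>x. (cmod (f x))\<^sup>2 \<partial>M)"
    using rep_ae_class_AE[of f M] by (intro integral_cong_AE) auto
  then show ?thesis by (simp add: l2_norm_def)
qed

lemma mult_op_bounded:
  assumes a: "a \<in> Linf M" shows "mult_op M a \<in> bounded_ops M"
proof -
  obtain C where [measurable]: "rep a \<in> borel_measurable M" and C: "AE x in M. cmod (rep a x) \<le> C"
    using rep_Linf[OF a] .
  note mult = square_integrable_mult[OF \<open>rep a \<in> borel_measurable M\<close> C rep_L2]
  have closed: "mult_op M a u \<in> L2 M" if "u \<in> L2 M" for u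
    using that by (simp add: mult_op_def ae_class_in_L2 mult)
  have "mult_op M a (l2_add M u v) = l2_add M (mult_op M a u) (mult_op M a v)"
    if [measurable]: "u \<in> L2 M" "v \<in> L2 M" for u v
  proof -
    note [measurable] = rep_L2_measurable[OF closed[OF that(1)]] rep_L2_measurable[OF closed[OF that(2)]]
      rep_L2_measurable[OF l2_add_closed[OF that]]
    have "AE x in M. rep (l2_add M u v) x = rep u x + rep v x"
      unfolding l2_add_def by (rule rep_ae_class_AE) simp
    moreover have "AE x in M. rep (mult_op M a u) x = rep a x * rep u x"
      using that by (simp add: mult_op_def rep_ae_class_AE)
    moreover have "AE x in M. rep (mult_op M a v) x = rep a x * rep v x"
      using that by (simp add: mult_op_def rep_ae_class_AE)
    ultimately have "AE x in M. rep a x * rep (l2_add M u v) x = rep (mult_op M a u) x + rep (mult_op M a v) x"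
      by eventually_elim (simp add: distrib_left)
    then have "ae_class M (\<lambda>x. rep a x * rep (l2_add M u v) x) = l2_add M (mult_op M a u) (mult_op M a v)"
      unfolding l2_add_def[of M "mult_op M a u"] by (subst ae_class_eq_iff) simp_all
    then show ?thesis using that by (simp add: mult_op_def)
  qed
  moreover have "mult_op M a (l2_scale M c u) = l2_scale M c (mult_op M a u)"
    if [measurable]: "u \<in> L2 M" for u c
  proof -
    note [measurable] = rep_L2_measurable[OF closed[OF that(1)]] rep_L2_measurable[OF l2_scale_closed[OF that]]
    have "AE x in M. rep (l2_scale M c u) x = c * rep u x"
      unfolding l2_scale_def by (rule rep_ae_class_AE) simp
    moreover have "AE x in M. rep (mult_op M a u) x = rep a x * rep u x"
      using that by (simp add: mult_op_def rep_ae_class_AE)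
    ultimately have "AE x in M. rep a x * rep (l2_scale M c u) x = c * rep (mult_op M a u) x"
      by eventually_elim simp
    then have "ae_class M (\<lambda>x. rep a x * rep (l2_scale M c u) x) = l2_scale M c (mult_op M a u)"
      unfolding l2_scale_def[of M c "mult_op M a u"] by (subst ae_class_eq_iff) simp_all
    then show ?thesis using that by (simp add: mult_op_def)
  qed
  moreover have "l2_norm M (mult_op M a u) \<le> \<bar>C\<bar> * l2_norm M u" if "u \<in> L2 M" for u
    using that mult by (simp add: mult_op_def l2_norm_ae_class) (simp add: l2_norm_def)
  moreover have "mult_op M a \<in> L2 M \<rightarrow>\<^sub>E L2 M"
    using closed by (auto simp: mult_op_def)
  ultimately show ?thesis unfolding bounded_ops_def by blast
qed

text \<open>The quadratic form is \<open>\<integral> a \<bar>u\<bar>\<^sup>2\<close>. In the order on the complex numbers, \<open>0 \<le> a\<close> includes that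
  \<open>a\<close> is real, which is what makes the integral real.\<close>

lemma mult_op_positive:
  assumes "Linf_positive M a" shows "op_positive M (mult_op M a)"
proof -
  have a: "a \<in> Linf M" and pos: "AE x in M. 0 \<le> rep a x"
    using assms by (auto simp: Linf_positive_def)
  obtain C where [measurable]: "rep a \<in> borel_measurable M" and C: "AE x in M. cmod (rep a x) \<le> C"
    using rep_Linf[OF a] .
  have "0 \<le> l2_inner M u (mult_op M a u)" if u[measurable]: "u \<in> L2 M" for u
  proof -
    have "l2_inner M u (mult_op M a u) = (\<integral>x. cnj (rep u x) * (rep a x * rep u x) \<partial>M)"
      using u C by (simp add: mult_op_def l2_inner_ae_class square_integrable_mult rep_L2)
    also have "\<dots> = (\<integral>x. complex_of_real (Re (rep a x) * (cmod (rep u x))\<^sup>2) \<partial>M)"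
    proof (rule integral_cong_AE)
      show "AE x in M. cnj (rep u x) * (rep a x * rep u x) =
        complex_of_real (Re (rep a x) * (cmod (rep u x))\<^sup>2)"
        using pos
      proof eventually_elim
        case (elim x)
        then have "rep a x = of_real (Re (rep a x))" by (simp add: less_eq_complex_def complex_eq_iff)
        then show ?case
          by (metis complex_norm_square mult.commute mult.left_commute of_real_mult)
      qed
    qed simp_all
    also have "\<dots> = of_real (\<integral>x. Re (rep a x) * (cmod (rep u x))\<^sup>2 \<partial>M)"
      by (rule integral_complex_of_real)
    also have "0 \<le> \<dots>"
    proof -
      have "0 \<le> (\<integral>x. Re (rep a x) * (cmod (rep u x))\<^sup>2 \<partial>M)"
        using pos by (intro integral_nonneg_AE) (auto simp: less_eq_complex_def)
      then show ?thesis by (simp add: less_eq_complex_def)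
    qed
    finally show ?thesis .
  qed
  then show ?thesis using mult_op_bounded[OF a] by (simp add: op_positive_def)
qed

lemma measurable_flow_map:
  assumes "measurable_flow M \<Phi>" shows "\<Phi> t \<in> measurable M M"
proof -
  have "(\<lambda>x. (\<lambda>(t, x). \<Phi> t x) (t, x)) \<in> measurable M M"
    by (rule measurable_compose[where N = "borel \<Otimes>\<^sub>M M"])
      (use assms in \<open>auto simp: measurable_flow_def\<close>)
  then show ?thesis by simp
qed

context
  fixes M :: "'x measure" and \<Phi> :: "real \<Rightarrow> 'x \<Rightarrow> 'x" and t :: real
  assumes flow_map [measurable]: "\<Phi> t \<in> measurable M M" and invariant: "distr M M (\<Phi> t) = M"
begin

text \<open>Invariance makes the preimage of a null set under the flow a null set, so that composition
  with the flow is well defined on almost everywhere classes.\<close>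

lemma AE_flow:
  assumes "AE x in M. P x" shows "AE x in M. P (\<Phi> t x)"
  by (rule AE_distrD[OF flow_map]) (unfold invariant, rule assms)

lemma square_integrable_flow:
  assumes f: "square_integrable M f"
  shows "square_integrable M (\<lambda>x. f (\<Phi> t x))"
    and "(\<integral>x. (cmod (f (\<Phi> t x)))\<^sup>2 \<partial>M) = (\<integral>x. (cmod (f x))\<^sup>2 \<partial>M)"
proof -
  have [measurable]: "f \<in> borel_measurable M" using f by (simp add: square_integrable_def)
  have "integrable (distr M M (\<Phi> t)) (\<lambda>x. (cmod (f x))\<^sup>2)"
    using f by (simp add: square_integrable_def invariant)
  then show "square_integrable M (\<lambda>x. f (\<Phi> t x))"
    by (subst (asm) integrable_distr_eq) (simp_all add: square_integrable_def)
  have "(\<integral>x. (cmod (f x))\<^sup>2 \<partial>distr M M (\<Phi> t)) = (\<integral>x. (cmod (f (\<Phi> t x)))\<^sup>2 \<partial>M)"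
    by (rule integral_distr) simp_all
  then show "(\<integral>x. (cmod (f (\<Phi> t x)))\<^sup>2 \<partial>M) = (\<integral>x. (cmod (f x))\<^sup>2 \<partial>M)"
    by (simp add: invariant)
qed

lemma koopman_isometry: "u \<in> L2 M \<Longrightarrow> l2_norm M (koopman M \<Phi> t u) = l2_norm M u"
  by (simp add: koopman_def l2_norm_ae_class square_integrable_flow rep_L2) (simp add: l2_norm_def)

lemma koopman_bounded: "koopman M \<Phi> t \<in> bounded_ops M"
proof -
  have closed: "koopman M \<Phi> t u \<in> L2 M" if "u \<in> L2 M" for u
    using that by (simp add: koopman_def ae_class_in_L2 square_integrable_flow rep_L2)
  have rep: "AE x in M. rep (koopman M \<Phi> t u) x = rep u (\<Phi> t x)" if [measurable]: "u \<in> L2 M" for u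
    using that by (simp add: koopman_def rep_ae_class_AE)
  have "koopman M \<Phi> t (l2_add M u v) = l2_add M (koopman M \<Phi> t u) (koopman M \<Phi> t v)"
    if [measurable]: "u \<in> L2 M" "v \<in> L2 M" for u v
  proof -
    note [measurable] = rep_L2_measurable[OF closed[OF that(1)]] rep_L2_measurable[OF closed[OF that(2)]]
    have "AE x in M. rep (l2_add M u v) x = rep u x + rep v x"
      unfolding l2_add_def by (rule rep_ae_class_AE) simp
    from AE_flow[OF this] rep[OF l2_add_closed[OF that]] rep[OF that(1)] rep[OF that(2)]
    have "AE x in M. rep (koopman M \<Phi> t (l2_add M u v)) x = rep (koopman M \<Phi> t u) x + rep (koopman M \<Phi> t v) x"
      by eventually_elim simp
    moreover have "AE x in M. rep (l2_add M (koopman M \<Phi> t u) (koopman M \<Phi> t v)) x =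
        rep (koopman M \<Phi> t u) x + rep (koopman M \<Phi> t v) x"
      unfolding l2_add_def[of M "koopman M \<Phi> t u"] by (rule rep_ae_class_AE) simp
    ultimately have "AE x in M. rep (koopman M \<Phi> t (l2_add M u v)) x =
        rep (l2_add M (koopman M \<Phi> t u) (koopman M \<Phi> t v)) x"
      by eventually_elim simp
    then show ?thesis using that by (intro L2_eqI_AE[where M = M]) (simp_all add: closed)
  qed
  moreover have "koopman M \<Phi> t (l2_scale M c u) = l2_scale M c (koopman M \<Phi> t u)"
    if [measurable]: "u \<in> L2 M" for u c
  proof -
    note [measurable] = rep_L2_measurable[OF closed[OF that]]
    have "AE x in M. rep (l2_scale M c u) x = c * rep u x"
      unfolding l2_scale_def by (rule rep_ae_class_AE) simp
    from AE_flow[OF this] rep[OF l2_scale_closed[OF that, of c]] rep[OF that]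
    have "AE x in M. rep (koopman M \<Phi> t (l2_scale M c u)) x = c * rep (koopman M \<Phi> t u) x"
      by eventually_elim simp
    moreover have "AE x in M. rep (l2_scale M c (koopman M \<Phi> t u)) x = c * rep (koopman M \<Phi> t u) x"
      unfolding l2_scale_def[of M c "koopman M \<Phi> t u"] by (rule rep_ae_class_AE) simp
    ultimately have "AE x in M. rep (koopman M \<Phi> t (l2_scale M c u)) x =
        rep (l2_scale M c (koopman M \<Phi> t u)) x"
      by eventually_elim simp
    then show ?thesis using that by (intro L2_eqI_AE[where M = M]) (simp_all add: closed)
  qed
  moreover have "\<forall>u\<in>L2 M. l2_norm M (koopman M \<Phi> t u) \<le> 1 * l2_norm M u"
    by (simp add: koopman_isometry)
  moreover have "koopman M \<Phi> t \<in> L2 M \<rightarrow>\<^sub>E L2 M"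
    using closed by (auto simp: koopman_def)
  ultimately show ?thesis unfolding bounded_ops_def by blast
qed

end

theorem mainTheorem3:
  fixes X :: "'x topology" and M :: "'x measure" and \<Phi> :: "real \<Rightarrow> 'x \<Rightarrow> 'x"
    and \<phi> :: "nat \<Rightarrow> ('x \<Rightarrow> complex) set" and L :: nat and t :: real
  assumes "completely_metrizable_space X" and "separable_space X"
    and "sets M = sets (sigma (topspace X) {U. openin X U})" and "prob_space M"
    and "measurable_flow M \<Phi>" and "flow_invariant M \<Phi>" and "flow_ergodic M \<Phi>"
    and "orthonormal_basis M \<phi>" and "\<And>j. \<phi> j \<in> Linf M"
  shows "completely_positive M (bounded_ops M) (BL M \<phi> L) (op_PiL M \<phi> L)
    \<and> (\<forall>A\<in>bounded_ops M. op_positive M A \<longrightarrow> op_positive M (op_PiL M \<phi> L A))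
    \<and> pi_L M \<phi> L \<in> Linf M \<rightarrow> BL M \<phi> L
    \<and> (\<forall>f\<in>Linf M. Linf_positive M f \<longrightarrow> op_positive M (pi_L M \<phi> L f))
    \<and> quantum_operation M (BL_algebra M \<phi> L) (BL_algebra M \<phi> L) (op_koopman_L M \<Phi> \<phi> L t)"
proof -
  interpret orthonormal_family M \<phi>
    using assms(8) by unfold_locales (auto simp: orthonormal_basis_def)
  have flow: "\<Phi> t \<in> measurable M M" "distr M M (\<Phi> t) = M"
    using assms(5,6) measurable_flow_map by (auto simp: flow_invariant_def)
  note K = koopman_bounded[where M = M and \<Phi> = \<Phi> and t = t, OF flow]
  note CP = op_PiL_completely_positive[of L]
  have U: "koopman_L M \<Phi> \<phi> L t \<in> BL M \<phi> L"
    unfolding koopman_L_def by (rule op_PiL_BL[OF K])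
  have contr: "l2_norm M (koopman_L M \<Phi> \<phi> L t u) \<le> l2_norm M u" if u: "u \<in> L2 M" for u
  proof -
    let ?p = "PiL M \<phi> L"
    have "l2_norm M (?p (koopman M \<Phi> t (?p u))) \<le> l2_norm M (koopman M \<Phi> t (?p u))"
      using u by (simp add: PiL_contraction bounded_ops_closed[OF K])
    also have "\<dots> \<le> l2_norm M u"
      using u by (simp add: koopman_isometry[where M = M and \<Phi> = \<Phi> and t = t, OF flow] PiL_contraction)
    finally show ?thesis
      using u by (simp add: koopman_L_def op_PiL_def op_comp_apply)
  qed
  obtain V where V: "V \<in> BL M \<phi> L" "adjoint_pair M (koopman_L M \<Phi> \<phi> L t) V"
    using BL_has_adjoint[OF U] .
  have "quantum_operation M (BL_algebra M \<phi> L) (BL_algebra M \<phi> L) (op_koopman_L M \<Phi> \<phi> L t)"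
    by (rule contraction_conjugation_quantum_operation[OF U V contr])
      (simp_all add: op_koopman_L_def op_adjoint_eq[OF V(2)])
  moreover have "op_positive M (op_PiL M \<phi> L A)" if "op_positive M A" for A
    using completely_positive_imp_positive[OF CP _ that] that by (simp add: op_positive_def)
  ultimately show ?thesis
    using CP by (simp add: pi_L_def op_PiL_BL mult_op_bounded mult_op_positive)
qed

end
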